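(* Let $m$ be a positive integer, $\lambda$ a real number with $2\lambda-m>0$, and $\mu_0=1$, $\mu_1,\dots,\mu_m>0$. For $g\in\tilde G$ and $z\in\mathbb D$ let $J(g,z)\in\mathbb C^{(m+1)\times(m+1)}$ be the matrix with entries $$J(g,z)_{p,\ell}=\begin{cases}\binom{p}{\ell}(-c_g)^{p-\ell}\,g'(z)^{\lambda-\frac m2+\frac{p+\ell}{2}} & p\ge \ell,\\ 0 & p<\ell,\end{cases}\qquad 0\le p,\ell\le m.$$ Then the image of the representation $\bigoplus_{j=0}^m D^+_{\lambda_j}$ under $\Gamma$, i.e. the representation $U(g)=\Gamma\circ\big(\bigoplus_{j=0}^m D^+_{\lambda_j}(g)\big)\circ\Gamma^{-1}$ of $\tilde G$ on $\mathbf A^{(\lambda,\boldsymbol\mu)}(\mathbb D)$, is a multiplier representation with multiplier $J$; that is, $J$ is a multiplier and $$(U(g)F)(z)=J(g^{-1},z)\,F(g^{-1}(z))$$ for all $g\in\tilde G$, $F\in\mathbf A^{(\lambda,\boldsymbol\mu)}(\mathbb D)$, $z\in\mathbb D$.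
   Context: $\mathbb D$ is the open unit disc in $\mathbb C$. $G$ is the group of Möbius transformations $z\mapsto\frac{az+b}{\bar bz+\bar a}$, $|a|^2-|b|^2=1$, of $\mathbb D$, and $\tilde G$ is its universal covering group, acting on $\mathbb D$ through $G$; for $g\in\tilde G$, $g(z)$ and $g'(z)$ refer to this action. For $\alpha\in\mathbb C$, $g'(z)^\alpha$ denotes the unique real analytic function on the simply connected set $\tilde G\times\mathbb D$, holomorphic in $z$, obtained by taking the principal branch of the power when $g$ is near the identity (so it equals $1$ at $g=e$). For $g\in\tilde G$, $c_g$ is the constant, depending real analytically on $g$ and independent of $z$, such that $g''(z)=-2c_g\,g'(z)^{3/2}$ for all $z\in\mathbb D$. A multiplier is a continuous function $J:\tilde G\times\mathbb D\to \mathrm{Hom}(V,V)$ ($V$ a finite dimensional Hilbert space), holomorphic in $z\in\mathbb D$, with $J(gh,z)=J(h,z)J(g,h(z))$ for all $g,h\in\tilde G$, $z\in\mathbb D$. For $\alpha>0$, $A^{(\alpha)}(\mathbb D)$ is the Hilbert space of holomorphic functions on $\mathbb D$ with reproducing kernel $(1-z\bar\omega)^{-2\alpha}$, and $D^+_\alpha$ is the unitary representation of $\tilde G$ on it given by $D_\alpha^+(g^{-1})f=(g')^\alpha\,(f\circ g)$. Put $2\lambda_j=2\lambda-m+2j$ for $0\le j\le m$ and let $(x)_n=x(x+1)\cdots(x+n-1)$. Vectors in $\mathbb C^{m+1}$ have components indexed by $0,\dots,m$. Define $\Gamma_j:A^{(\lambda_j)}(\mathbb D)\to \mathrm{Hol}(\mathbb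 D,\mathbb C^{m+1})$ by $(\Gamma_jf)_\ell=\binom{\ell}{j}\frac{1}{(2\lambda_j)_{\ell-j}}f^{(\ell-j)}$ if $\ell\ge j$ and $(\Gamma_jf)_\ell=0$ if $\ell<j$. The sum of the images of $\Gamma_0,\dots,\Gamma_m$ is direct and each $\Gamma_j$ is injective. $\mathbf A^{(\lambda,\boldsymbol\mu)}(\mathbb D)$, $\boldsymbol\mu=(\mu_0,\dots,\mu_m)$, is this direct sum of images, with the inner product $\langle\sum_j\Gamma_jf_j,\sum_j\Gamma_jg_j\rangle=\sum_j\mu_j^{-2}\langle f_j,g_j\rangle_{A^{(\lambda_j)}}$. Finally $\Gamma=\bigoplus_{j}\mu_j\Gamma_j:\bigoplus_jA^{(\lambda_j)}(\mathbb D)\to\mathbf A^{(\lambda,\boldsymbol\mu)}(\mathbb D)$, $(f_j)_j\mapsto\sum_j\mu_j\Gamma_jf_j$. *)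

theory Defs
  imports
    "HOL-Complex_Analysis.Complex_Analysis"
    "HOL-Algebra.Bij"
    "Jordan_Normal_Form.Matrix"
begin

unbundle no vec_syntax

abbreviation disc :: "complex set" where
  "disc \<equiv> ball 0 1"

subsection \<open>The Moebius group of the disc and its universal covering group\<close>

text \<open>
  Moebius transformations are functions on the disc, extended by \<^term>\<open>undefined\<close> as in
  \<^term>\<open>BijGroup disc\<close>, which supplies the group structure (composition).  As a subset of
  \<^typ>\<open>complex \<Rightarrow> complex\<close> this set carries the topology of pointwise convergence, which on
  Moebius transformations of the disc agrees with the Lie group topology (the quotient topology
  from the matrices with parameters \<open>(a, b)\<close>): \<open>g\<close> is determined, continuously, by its values
  at three points.
\<close>

definition moebius_group :: "(complex \<Rightarrow> complex) set" where
  "moebius_group =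
     {restrict (\<lambda>z. (a * z + b) / (cnj b * z + cnj a)) disc | a b. (cmod a)\<^sup>2 - (cmod b)\<^sup>2 = 1}"

text \<open>
  The universal covering group is not constructed: \<open>Gt\<close> is any simply connected topological
  group with a covering homomorphism \<open>act\<close> onto the Moebius group, so that \<open>act g z\<close> is \<open>g(z)\<close>.
  Such a group is unique up to isomorphism.
\<close>

definition universal_covering_group ::
    "('g::topological_space) monoid \<Rightarrow> ('g \<Rightarrow> complex \<Rightarrow> complex) \<Rightarrow> bool" where
  "universal_covering_group Gt act \<longleftrightarrow>
     group Gt \<and>
     continuous_on (carrier Gt \<times> carrier Gt) (\<lambda>(g, h). g \<otimes>\<^bsub>Gt\<^esub> h) \<and>
     continuous_on (carrier Gt) (\<lambda>g. inv\<^bsub>Gt\<^esub> g) \<and>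
     simply_connected (carrier Gt) \<and>
     act \<in> hom Gt (BijGroup disc) \<and>
     covering_space (carrier Gt) act moebius_group"

text \<open>
  \<open>P g z\<close> is the branch of \<open>g'(z)\<^sup>\<alpha>\<close> on \<open>Gt \<times> disc\<close> obtained from the principal branch near
  the identity: a continuous selection of the many-valued power.  There is exactly one.  It is
  real analytic, since \<open>g'(z)\<close> is real analytic and has no zeros, and a real analytic function
  that is the principal power near the identity is conversely such a selection.
\<close>

definition derivative_power ::
    "('g::topological_space) monoid \<Rightarrow> ('g \<Rightarrow> complex \<Rightarrow> complex) \<Rightarrow> complex \<Rightarrow>
     ('g \<Rightarrow> complex \<Rightarrow> complex) \<Rightarrow> bool" where
  "derivative_power Gt act \<alpha> P \<longleftrightarrow>
     continuous_on (carrier Gt \<times> disc) (\<lambda>(g, z). P g z) \<and>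
     (\<forall>g \<in> carrier Gt. P g holomorphic_on disc) \<and>
     (\<forall>g \<in> carrier Gt. \<forall>z \<in> disc. \<exists>w. exp w = deriv (act g) z \<and> P g z = exp (\<alpha> * w)) \<and>
     (\<exists>N. openin (top_of_set (carrier Gt)) N \<and> \<one>\<^bsub>Gt\<^esub> \<in> N \<and>
          (\<forall>g \<in> N. \<forall>z \<in> disc. P g z = deriv (act g) z powr \<alpha>))"

text \<open>
  The uniqueness in \<^const>\<open>derivative_power\<close> concerns arguments in \<open>Gt \<times> disc\<close> only, so the
  value is selected rather than the function.
\<close>

definition dpow ::
    "('g::topological_space) monoid \<Rightarrow> ('g \<Rightarrow> complex \<Rightarrow> complex) \<Rightarrow> complex \<Rightarrow>
     'g \<Rightarrow> complex \<Rightarrow> complex" where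
  "dpow Gt act \<alpha> g z = (THE w. \<exists>P. derivative_power Gt act \<alpha> P \<and> w = P g z)"

definition c_const ::
    "('g::topological_space) monoid \<Rightarrow> ('g \<Rightarrow> complex \<Rightarrow> complex) \<Rightarrow> 'g \<Rightarrow> complex" where
  "c_const Gt act g =
     (THE c. \<forall>z \<in> disc. deriv (deriv (act g)) z = - 2 * c * dpow Gt act (3 / 2) g z)"

subsection \<open>Multipliers\<close>

definition multiplier ::
    "('g::topological_space) monoid \<Rightarrow> ('g \<Rightarrow> complex \<Rightarrow> complex) \<Rightarrow> nat \<Rightarrow>
     ('g \<Rightarrow> complex \<Rightarrow> complex mat) \<Rightarrow> bool" where
  "multiplier Gt act n J \<longleftrightarrow>
     (\<forall>g \<in> carrier Gt. \<forall>z \<in> disc. J g z \<in> carrier_mat n n) \<and>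
     (\<forall>p < n. \<forall>l < n.
        continuous_on (carrier Gt \<times> disc) (\<lambda>(g, z). J g z $$ (p, l)) \<and>
        (\<forall>g \<in> carrier Gt. (\<lambda>z. J g z $$ (p, l)) holomorphic_on disc)) \<and>
     (\<forall>g \<in> carrier Gt. \<forall>h \<in> carrier Gt. \<forall>z \<in> disc.
        J (g \<otimes>\<^bsub>Gt\<^esub> h) z = J h z * J g (act h z))"

definition J_mat ::
    "('g::topological_space) monoid \<Rightarrow> ('g \<Rightarrow> complex \<Rightarrow> complex) \<Rightarrow> nat \<Rightarrow> real \<Rightarrow>
     'g \<Rightarrow> complex \<Rightarrow> complex mat" where
  "J_mat Gt act m lam g z = mat (m + 1) (m + 1) (\<lambda>(p, l).
     if l \<le> p
     then of_nat (p choose l) * (- c_const Gt act g) ^ (p - l) *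
          dpow Gt act (of_real (lam - real m / 2 + real (p + l) / 2)) g z
     else 0)"

subsection \<open>Hilbert spaces of functions on the disc\<close>

text \<open>
  Functions on the disc are represented by functions on \<^typ>\<open>complex\<close> vanishing off the disc.
  Inner products are linear in the first argument.
\<close>

record 'v fun_space = "(complex \<Rightarrow> 'v) partial_object" +
  ip :: "(complex \<Rightarrow> 'v) \<Rightarrow> (complex \<Rightarrow> 'v) \<Rightarrow> complex"

definition norm_sq :: "complex fun_space \<Rightarrow> (complex \<Rightarrow> complex) \<Rightarrow> real" where
  "norm_sq H f = Re (ip H f f)"

definition holomorphic_hilbert_space :: "complex fun_space \<Rightarrow> bool" where
  "holomorphic_hilbert_space H \<longleftrightarrow>
     (\<forall>f \<in> carrier H. f holomorphic_on disc \<and> (\<forall>z. z \<notin> disc \<longrightarrow> f z = 0)) \<and>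
     (\<lambda>z. 0) \<in> carrier H \<and>
     (\<forall>f \<in> carrier H. \<forall>g \<in> carrier H. (\<lambda>z. f z + g z) \<in> carrier H) \<and>
     (\<forall>c. \<forall>f \<in> carrier H. (\<lambda>z. c * f z) \<in> carrier H) \<and>
     (\<forall>f \<in> carrier H. \<forall>g \<in> carrier H. \<forall>h \<in> carrier H.
        ip H (\<lambda>z. f z + g z) h = ip H f h + ip H g h) \<and>
     (\<forall>c. \<forall>f \<in> carrier H. \<forall>g \<in> carrier H. ip H (\<lambda>z. c * f z) g = c * ip H f g) \<and>
     (\<forall>f \<in> carrier H. \<forall>g \<in> carrier H. ip H g f = cnj (ip H f g)) \<and>
     (\<forall>f \<in> carrier H. f \<noteq> (\<lambda>z. 0) \<longrightarrow> 0 < norm_sq H f) \<and>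
     (\<forall>x. (\<forall>n::nat. x n \<in> carrier H) \<and>
          (\<forall>e>0. \<exists>N. \<forall>i\<ge>N. \<forall>k\<ge>N. norm_sq H (\<lambda>z. x i z - x k z) < e) \<longrightarrow>
          (\<exists>f \<in> carrier H. (\<lambda>n. norm_sq H (\<lambda>z. x n z - f z)) \<longlonglongrightarrow> 0))"

definition reproducing_kernel :: "complex fun_space \<Rightarrow> (complex \<Rightarrow> complex \<Rightarrow> complex) \<Rightarrow> bool" where
  "reproducing_kernel H K \<longleftrightarrow>
     (\<forall>w \<in> disc. (\<lambda>z. if z \<in> disc then K z w else 0) \<in> carrier H \<and>
        (\<forall>f \<in> carrier H. f w = ip H f (\<lambda>z. if z \<in> disc then K z w else 0)))"

text \<open>
  A Hilbert space of functions is determined by its reproducing kernel, so \<open>H\<close> is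
  \<open>A\<^sup>(\<^sup>\<alpha>\<^sup>)(disc)\<close>.  As \<open>Re (1 - z * cnj w) > 0\<close> on the disc, \<open>powr\<close> is the branch that equals
  \<open>1\<close> for \<open>w = 0\<close>.
\<close>

definition is_A :: "real \<Rightarrow> complex fun_space \<Rightarrow> bool" where
  "is_A \<alpha> H \<longleftrightarrow> holomorphic_hilbert_space H \<and>
     reproducing_kernel H (\<lambda>z w. (1 - z * cnj w) powr of_real (- 2 * \<alpha>))"

definition D_plus ::
    "('g::topological_space) monoid \<Rightarrow> ('g \<Rightarrow> complex \<Rightarrow> complex) \<Rightarrow> real \<Rightarrow> 'g \<Rightarrow>
     (complex \<Rightarrow> complex) \<Rightarrow> complex \<Rightarrow> complex" where
  "D_plus Gt act \<alpha> g f =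
     (\<lambda>z. if z \<in> disc
          then dpow Gt act (of_real \<alpha>) (inv\<^bsub>Gt\<^esub> g) z * f (act (inv\<^bsub>Gt\<^esub> g) z)
          else 0)"

subsection \<open>The operators \<open>\<Gamma>\<^sub>j\<close> and the space \<open>A\<^sup>(\<^sup>\<lambda>\<^sup>,\<^sup>\<mu>\<^sup>)\<close>\<close>

definition lam_j :: "nat \<Rightarrow> real \<Rightarrow> nat \<Rightarrow> real" where
  "lam_j m lam j = (2 * lam - real m + 2 * real j) / 2"

definition Gamma_j ::
    "nat \<Rightarrow> real \<Rightarrow> nat \<Rightarrow> (complex \<Rightarrow> complex) \<Rightarrow> complex \<Rightarrow> complex vec" where
  "Gamma_j m lam j f = (\<lambda>z. vec (m + 1) (\<lambda>l.
     if z \<in> disc \<and> j \<le> l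
     then of_nat (l choose j) / of_real (pochhammer (2 * lam_j m lam j) (l - j)) *
          (deriv ^^ (l - j)) f z
     else 0))"

text \<open>\<open>(f\<^sub>j) \<mapsto> \<Sum>\<^sub>j w\<^sub>j \<Gamma>\<^sub>j f\<^sub>j\<close>; the operator \<open>\<Gamma>\<close> is the case \<open>w = \<mu>\<close>.\<close>

definition Gamma_sum ::
    "nat \<Rightarrow> real \<Rightarrow> (nat \<Rightarrow> real) \<Rightarrow> (nat \<Rightarrow> complex \<Rightarrow> complex) \<Rightarrow> complex \<Rightarrow> complex vec" where
  "Gamma_sum m lam w f = (\<lambda>z. vec (m + 1) (\<lambda>l.
     \<Sum>j\<le>m. of_real (w j) * vec_index (Gamma_j m lam j (f j) z) l))"

definition direct_sum :: "nat \<Rightarrow> (nat \<Rightarrow> complex fun_space) \<Rightarrow> (nat \<Rightarrow> complex \<Rightarrow> complex) set" where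
  "direct_sum m A = (\<Pi>\<^sub>E j\<in>{..m}. carrier (A j))"

definition A_lam_mu ::
    "nat \<Rightarrow> real \<Rightarrow> (nat \<Rightarrow> real) \<Rightarrow> (nat \<Rightarrow> complex fun_space) \<Rightarrow> complex vec fun_space" where
  "A_lam_mu m lam mu A =
     (let S = Gamma_sum m lam (\<lambda>j. 1); comps = inv_into (direct_sum m A) S
      in \<lparr>carrier = S ` direct_sum m A,
          ip = (\<lambda>F G. \<Sum>j\<le>m. of_real (1 / (mu j)\<^sup>2) * ip (A j) (comps F j) (comps G j))\<rparr>)"

definition D_plus_sum ::
    "('g::topological_space) monoid \<Rightarrow> ('g \<Rightarrow> complex \<Rightarrow> complex) \<Rightarrow> nat \<Rightarrow> real \<Rightarrow> 'g \<Rightarrow>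
     (nat \<Rightarrow> complex \<Rightarrow> complex) \<Rightarrow> nat \<Rightarrow> complex \<Rightarrow> complex" where
  "D_plus_sum Gt act m lam g f = (\<lambda>j\<in>{..m}. D_plus Gt act (lam_j m lam j) g (f j))"

definition U_rep ::
    "('g::topological_space) monoid \<Rightarrow> ('g \<Rightarrow> complex \<Rightarrow> complex) \<Rightarrow> nat \<Rightarrow> real \<Rightarrow> (nat \<Rightarrow> real) \<Rightarrow>
     (nat \<Rightarrow> complex fun_space) \<Rightarrow> 'g \<Rightarrow> (complex \<Rightarrow> complex vec) \<Rightarrow> complex \<Rightarrow> complex vec" where
  "U_rep Gt act m lam mu A g F =
     Gamma_sum m lam mu
       (D_plus_sum Gt act m lam g (inv_into (direct_sum m A) (Gamma_sum m lam mu) F))"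

end

theory Submission
  imports Defs
begin

text \<open>
  On the disc, \<open>g(z) = (u z + b) / (1 + cnj b u z)\<close> with \<open>|u| = 1\<close>, \<open>|b| < 1\<close>, and \<open>u\<close> has a continuous
  logarithm \<open>\<theta>\<close> on the simply connected covering group.  Hence
  \<open>L(g, z) = \<theta> + ln (1 - |b|\<^sup>2) - 2 Ln (1 + cnj b u z)\<close> is a continuous logarithm of \<open>g'(z)\<close>, so that
  \<open>g'(z)\<^sup>\<alpha> = exp (\<alpha> L)\<close>.  By connectedness \<open>L(gh, z) = L(h, z) + L(g, h(z))\<close>; differentiating in \<open>z\<close>
  gives the composition rule for \<open>c\<^sub>g\<close>, and the binomial theorem then gives the multiplier identity for \<open>J\<close>.
  The intertwining relation is the expansion of the derivatives of \<open>(g')\<^sup>\<alpha> (f \<circ> g)\<close>, which follows by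
  induction from \<open>\<partial>L/\<partial>z = -2 c\<^sub>g (g')\<^sup>1\<^sup>/\<^sup>2\<close>.  The discrete series operators preserve their spaces because
  they carry kernel functions isometrically to multiples of kernel functions.
\<close>

subsection \<open>Lifting continuous functions through the exponential\<close>

text \<open>\<open>Gt\<close> is known only as an abstract topological group, so the logarithm of
  \<open>u\<close> is built by hand from winding numbers of images of paths. Its continuity needs
  local path-connectedness, which is not among the defining properties of the cover; it is pulled
  back along the covering map from the Moebius group, itself a product of a circle and a disc.
  \<open>dpow\<close> and \<open>c_const\<close> are definite descriptions, so nothing about
  \<open>J_mat\<close> can be computed until the explicit exponentials are known to be the only
  solutions. All exponents in \<open>J_mat\<close> differ from \<open>lam - m / 2\<close> by
  multiples of 1/2. Hence \<open>exp (L / 2)\<close> is the basic quantity: every entry is a fixed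
  exponential times a natural power of it, which reduces the identities to ring arithmetic. Each
  \<open>A j\<close> is given only by completeness and its kernel. That a transformed function
  belongs to it is therefore obtained from completeness, by approximation with kernels; point
  evaluations are bounded, so a pointwise comparison identifies the limit.\<close>

lemma locally_path_connected_local_homeomorphism:
  assumes S: "locally path_connected S"
    and loc: "\<And>x. x \<in> C \<Longrightarrow> \<exists>T u p q. x \<in> T \<and> openin (top_of_set C) T \<and>
                openin (top_of_set S) u \<and> homeomorphism T u p q"
  shows "locally path_connected C"
proof (rule locallyI)
  fix w x assume w: "openin (top_of_set C) w" and x: "x \<in> w"
  then have "x \<in> C" using openin_imp_subset by blast
  then obtain T u p q where T: "x \<in> T" "openin (top_of_set C) T"
      and u: "openin (top_of_set S) u" and h: "homeomorphism T u p q"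
    using loc by blast
  have TC: "T \<subseteq> C" using T openin_imp_subset by blast
  have "openin (top_of_set C) (w \<inter> T)" using w T by blast
  then have wT: "openin (top_of_set T) (w \<inter> T)"
    by (rule openin_subset_trans) (use TC in auto)
  have "openin (top_of_set u) (p ` (w \<inter> T))"
    by (rule homeomorphism_imp_open_map[OF h wT])
  then have "openin (top_of_set S) (p ` (w \<inter> T))"
    using u openin_trans by blast
  moreover have "p x \<in> p ` (w \<inter> T)" using x T by blast
  ultimately obtain V where V: "openin (top_of_set S) V" "path_connected V" "p x \<in> V"
      "V \<subseteq> p ` (w \<inter> T)"
    using S unfolding locally_path_connected by blast
  have Vu: "V \<subseteq> u" using V(4) h unfolding homeomorphism_def by blast
  have "openin (top_of_set u) V"
    by (rule openin_subset_trans[OF V(1) Vu]) (use u openin_imp_subset in blast)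
  then have "openin (top_of_set T) (q ` V)"
    using homeomorphism_imp_open_map[OF homeomorphism_symD[OF h]] by blast
  then have o: "openin (top_of_set C) (q ` V)" using T openin_trans by blast
  have pc: "path_connected (q ` V)"
    using h V(2) Vu unfolding homeomorphism_def
    by (meson continuous_on_subset path_connected_continuous_image)
  have "x \<in> q ` V" using V(3) T h unfolding homeomorphism_def by force
  moreover have "q ` V \<subseteq> w"
    using V(4) h unfolding homeomorphism_def by force
  ultimately show "\<exists>U V. openin (top_of_set C) U \<and> path_connected V \<and> x \<in> U \<and> U \<subseteq> V \<and> V \<subseteq> w"
    using o pc by blast
qed

text \<open>The constant loops at two points are homotopic, and following the base point through the
  homotopy gives a path between them.\<close>

lemma simply_connected_path_connected:
  assumes "simply_connected S"
  shows "path_connected S"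
proof -
  have "path_component S a b" if "a \<in> S" "b \<in> S" for a b
  proof -
    have "homotopic_loops S (\<lambda>_. a) (\<lambda>_. b)"
      using assms[unfolded simply_connected_def, rule_format, of "\<lambda>_. a" "\<lambda>_. b"] that
      by (auto simp: path_def pathstart_def pathfinish_def path_image_def)
    then show ?thesis
      using homotopic_loops_imp_path_component_value[of S "\<lambda>_. a" "\<lambda>_. b" 0] by simp
  qed
  then show ?thesis
    by (simp add: path_connected_component)
qed

text \<open>Every loop in \<open>S\<close> contracts to a constant one, and winding numbers are
  invariant under homotopies avoiding 0. This makes the lift below independent of the chosen
  path.\<close>

lemma winding_number_simply_connected_loop:
  fixes f :: "'a::topological_space \<Rightarrow> complex"
  assumes "simply_connected S" "continuous_on S f" "\<And>z. z \<in> S \<Longrightarrow> f z \<noteq> 0"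
    and "path p" "path_image p \<subseteq> S" "pathfinish p = pathstart p"
  shows "winding_number (f \<circ> p) 0 = 0"
proof -
  let ?a = "pathstart p"
  have "?a \<in> S" using assms(5) by auto
  then have "homotopic_loops S p (\<lambda>_. ?a)"
    using assms(1)[unfolded simply_connected_def, rule_format, of p "\<lambda>_. ?a"] assms(4,5,6)
    by (auto simp: path_def pathstart_def pathfinish_def path_image_def)
  then have "homotopic_loops (- {0}) (f \<circ> p) (f \<circ> (\<lambda>_. ?a))"
    by (rule homotopic_loops_continuous_image) (use assms in auto)
  moreover have "f \<circ> (\<lambda>_. ?a) = linepath (f ?a) (f ?a)"
    by (auto simp: linepath_def algebra_simps)
  ultimately have "winding_number (f \<circ> p) 0 = winding_number (linepath (f ?a) (f ?a)) 0"
    using winding_number_homotopic_loops by metis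
  then show ?thesis
    using assms(3) \<open>?a \<in> S\<close> by (simp add: winding_number_trivial)
qed

lemma exp_log_increment:
  assumes "path p" "0 \<notin> path_image p"
  shows "pathfinish p = pathstart p * exp (2 * of_real pi * \<i> * winding_number p 0)"
proof -
  obtain q where q: "pathfinish q - pathstart q = 2 * of_real pi * \<i> * winding_number p 0"
      "\<And>t. t \<in> {0..1} \<Longrightarrow> p t = 0 + exp (q t)"
    using winding_number_as_continuous_log[OF assms] by metis
  have "pathfinish p = exp (pathfinish q)" "pathstart p = exp (pathstart q)"
    using q(2)[of 0] q(2)[of 1] by (auto simp: pathfinish_def pathstart_def)
  then show ?thesis using q(1) by (metis exp_add add_diff_cancel_left' diff_add_cancel add.commute)
qed

text \<open>On the half-plane around \<open>pathstart p\<close>,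
  \<open>Ln (p t / pathstart p)\<close> is continuous in \<open>t\<close>, so it differs from any
  continuous logarithm along \<open>p\<close> by a continuous function with values in a coset of the
  multiples of 2 pi i, hence by a constant. This makes the lift explicit near a point.\<close>

lemma log_increment_halfplane:
  assumes p: "path p" "\<And>t. t \<in> {0..1} \<Longrightarrow> 0 < Re (p t / pathstart p)"
  shows "2 * of_real pi * \<i> * winding_number p 0 = Ln (pathfinish p / pathstart p)"
proof -
  have nz: "0 \<notin> path_image p" using p(2) by (force simp: path_image_def)
  obtain q where q: "path q" "pathfinish q - pathstart q = 2 * of_real pi * \<i> * winding_number p 0"
      "\<And>t. t \<in> {0..1} \<Longrightarrow> p t = 0 + exp (q t)"
    using winding_number_as_continuous_log[OF p(1) nz] by metis
  define d where "d = (\<lambda>t. q t - Ln (p t / pathstart p))"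
  have nn: "p t / pathstart p \<notin> \<real>\<^sub>\<le>\<^sub>0" if "t \<in> {0..1}" for t
    using p(2)[OF that] by (auto simp: complex_nonpos_Reals_iff)
  have nz0: "pathstart p \<noteq> 0" using nz by (metis pathstart_in_path_image)
  have cont: "continuous_on {0..1} d"
    unfolding d_def using p(1) q(1) nn nz0 by (intro continuous_intros) (auto simp: path_def)
  have ex: "exp (d t) = pathstart p" if "t \<in> {0..1}" for t
    using q(3)[OF that] nz0 by (simp add: d_def exp_diff)
  have "d constant_on {0..1}"
  proof (rule continuous_discrete_range_constant)
    fix x :: real assume x: "x \<in> {0..1}"
    have "2 * pi \<le> norm (d y - d x)" if y: "y \<in> {0..1}" "d y \<noteq> d x" for y
    proof -
      have "exp (d y) = exp (d x)" using ex x y by simp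
      then obtain n::int where n: "d y = d x + (of_int (2*n) * pi) * \<i>" by (metis exp_eq)
      with y have "n \<noteq> 0" by auto
      then have "1 \<le> \<bar>real_of_int n\<bar>" by linarith
      then show ?thesis using n by (simp add: norm_mult)
    qed
    then show "\<exists>e>0. \<forall>y. y \<in> {0..1} \<and> d y \<noteq> d x \<longrightarrow> e \<le> cmod (d y - d x)"
      by (intro exI[of _ "2*pi"]) auto
  qed (use cont in auto)
  then have "d 1 = d 0" unfolding constant_on_def by force
  then have "Ln (pathfinish p / pathstart p) = pathfinish q - pathstart q"
    using nz0 by (simp add: d_def pathfinish_def pathstart_def algebra_simps)
  then show ?thesis using q(2) by simp
qed

text \<open>The value at \<open>x\<close> is the logarithmic increment \<open>W\<close> of
  \<open>f\<close> along any path from \<open>e\<close> to \<open>x\<close>; vanishing on loops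
  makes it path-independent. Local path-connectedness lets nearby points be joined inside a set
  where the increment is given by \<open>Ln\<close>.\<close>

lemma continuous_logarithm_simply_connected:
  fixes f :: "'a::topological_space \<Rightarrow> complex"
  assumes contf: "continuous_on S f" and S: "simply_connected S" "locally path_connected S"
    and f: "\<And>z. z \<in> S \<Longrightarrow> f z \<noteq> 0"
    and e: "e \<in> S" "f e = 1"
  obtains g where "continuous_on S g" "g e = 0" "\<And>x. x \<in> S \<Longrightarrow> f x = exp (g x)"
proof -
  define W where "W p = 2 * of_real pi * \<i> * winding_number (f \<circ> p) 0" for p
  define good where "good p x y \<longleftrightarrow> path p \<and> path_image p \<subseteq> S \<and> pathstart p = x \<and> pathfinish p = y"
    for p x y
  have fp: "path (f \<circ> p)" "0 \<notin> path_image (f \<circ> p)" "pathstart (f \<circ> p) = f x"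
      "pathfinish (f \<circ> p) = f y" if "good p x y" for p x y
    using that contf f unfolding good_def
    by (auto intro!: path_continuous_image intro: continuous_on_subset
        simp: path_image_compose pathstart_compose pathfinish_compose)
  have Wexp: "f y = f x * exp (W p)" if "good p x y" for p x y
    using exp_log_increment[OF fp(1,2)[OF that]] fp(3,4)[OF that] by (simp add: W_def)
  have Wjoin: "W (p +++ q) = W p + W q" if "good p x y" "good q y z" for p q x y z
    using winding_number_join[OF fp(1,2)[OF that(1)] fp(1,2)[OF that(2)]] fp[OF that(1)] fp[OF that(2)]
    by (simp add: W_def path_compose_join algebra_simps)
  have Wrev: "W (reversepath p) = - W p" if "good p x y" for p x y
    using winding_number_reversepath[OF fp(1,2)[OF that]]
    by (simp add: W_def path_compose_reversepath)
  have gjoin: "good (p +++ q) x z" if "good p x y" "good q y z" for p q x y z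
    using that by (auto simp: good_def path_image_join)
  have grev: "good (reversepath p) y x" if "good p x y" for p x y
    using that by (auto simp: good_def)
  have Wloop: "W p = 0" if "good p x x" for p x
    using winding_number_simply_connected_loop[OF S(1) contf f] that by (simp add: W_def good_def)
  have Wuniq: "W p = W q" if "good p x y" "good q x y" for p q x y
    using Wloop[OF gjoin[OF that(1) grev[OF that(2)]]] Wjoin[OF that(1) grev[OF that(2)]]
      Wrev[OF that(2)] by simp
  have "\<exists>p. good p e x" if "x \<in> S" for x
    using simply_connected_path_connected[OF S(1)] that e unfolding path_connected_def good_def
    by blast
  then obtain P where P: "\<And>x. x \<in> S \<Longrightarrow> good (P x) e x" by metis
  define g where "g x = W (P x)" for x
  have fexp: "f x = exp (g x)" if "x \<in> S" for x
    using Wexp[OF P[OF that]] e by (simp add: g_def)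
  have ge: "g e = 0" using Wloop[OF P[OF e(1)]] by (simp add: g_def)
  have step: "g y = g x + W p" if "x \<in> S" "y \<in> S" "good p x y" for x y p
    using Wuniq[OF P[OF that(2)] gjoin[OF P[OF that(1)] that(3)]] Wjoin[OF P[OF that(1)] that(3)]
    by (simp add: g_def)
  have "continuous_on S g"
    unfolding continuous_on_def
  proof
    fix x assume x: "x \<in> S"
    have ct: "continuous_on S (\<lambda>y. Re (f y / f x))"
      using contf f[OF x] by (intro continuous_intros) auto
    \<comment> \<open>On \<open>w\<close> the quotient \<open>f y / f x\<close> stays in the right
      half-plane, so along a path in \<open>w\<close> starting at \<open>x\<close> the increment is
      the principal logarithm.\<close>
    define w where "w = S \<inter> (\<lambda>y. Re (f y / f x)) -` {0<..}"
    have w: "openin (top_of_set S) w" unfolding w_def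
      by (rule continuous_openin_preimage_gen[OF ct]) auto
    have "x \<in> w" using x f[OF x] by (simp add: w_def)
    then obtain U where U: "openin (top_of_set S) U" "path_connected U" "x \<in> U" "U \<subseteq> w"
      using S(2) w unfolding locally_path_connected by blast
    have US: "U \<subseteq> S" using U(4) by (auto simp: w_def)
    have loc: "g y = g x + Ln (f y / f x)" if y: "y \<in> U" for y
    proof -
      obtain p where p: "path p" "path_image p \<subseteq> U" "pathstart p = x" "pathfinish p = y"
        using U y unfolding path_connected_def by blast
      have gp: "good p x y" using p US by (auto simp: good_def)
      have "W p = Ln (f y / f x)"
        using log_increment_halfplane[OF fp(1)[OF gp]] p(2) U(4) fp[OF gp]
        by (force simp: W_def w_def path_image_def)
      then show ?thesis using step[OF x _ gp] y US by auto
    qed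
    have f0: "(f \<longlongrightarrow> f x) (at x within S)" using contf x unfolding continuous_on_def by blast
    have c: "((\<lambda>y. g x + Ln (f y / f x)) \<longlongrightarrow> g x + Ln (f x / f x)) (at x within S)"
      by (rule tendsto_add[OF tendsto_const tendsto_Ln[OF tendsto_divide[OF f0 tendsto_const]]])
        (use f[OF x] in auto)
    obtain O' where O': "open O'" "U = S \<inter> O'" using U(1) by (auto simp: openin_open)
    have "eventually (\<lambda>y. y \<in> U) (at x within S)"
      unfolding eventually_at_topological
      using O' U(3) by (intro exI[of _ O']) auto
    then have "eventually (\<lambda>y. g x + Ln (f y / f x) = g y) (at x within S)"
      by (rule eventually_mono) (simp only: loc)
    from Lim_transform_eventually[OF c this] show "(g \<longlongrightarrow> g x) (at x within S)"
      using f[OF x] by simp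
  qed
  then show thesis using that ge fexp by blast
qed

section \<open>Continuous maps with countable range\<close>

text \<open>A connected subset of a metric space with two points is uncountable. Countability,
  unlike discreteness, also covers the values \<open>exp (2 * pi * \<i> * n * \<alpha>)\<close>,
  which for irrational real \<alpha> are dense in the circle.\<close>

lemma countable_range_constant:
  fixes f :: "'a::topological_space \<Rightarrow> 'b::metric_space"
  assumes "connected S" "continuous_on S f" "countable (f ` S)" "x \<in> S" "y \<in> S"
  shows "f x = f y"
  using connected_uncountable[OF connected_continuous_image[OF assms(2,1)], of "f x" "f y"] assms
  by blast

lemma exp_difference_constant:
  fixes f g :: "'a::topological_space \<Rightarrow> complex"
  assumes "connected S" "continuous_on S f" "continuous_on S g"
    and "\<And>x. x \<in> S \<Longrightarrow> exp (f x) = exp (g x)"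
    and "x \<in> S" "y \<in> S" "f x = g x"
  shows "f y = g y"
proof -
  have "(\<lambda>x. f x - g x) ` S \<subseteq> range (\<lambda>n::int. of_int (2*n) * pi * \<i>)"
  proof clarify
    fix x assume "x \<in> S"
    then obtain n::int where "f x = g x + (of_int (2*n) * pi) * \<i>" using assms(4) by (metis exp_eq)
    then show "f x - g x \<in> range (\<lambda>n::int. of_int (2*n) * pi * \<i>)" by auto
  qed
  then have "countable ((\<lambda>x. f x - g x) ` S)" by (meson countable_subset countableI_type countable_image)
  then have "f x - g x = f y - g y"
    using countable_range_constant[of S "\<lambda>x. f x - g x" x y] assms
    by (auto intro: continuous_intros)
  then show ?thesis using assms(7) by simp
qed

subsection \<open>Moebius transformations of the disc\<close>

text \<open>The second parameter is the image of 0, the first is \<open>a / cnj a\<close> for the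
  matrix entry \<open>a\<close>. Unlike the matrix, which is determined only up to sign, these
  parameters are unique and depend continuously on the transformation.\<close>

definition mob :: "complex \<Rightarrow> complex \<Rightarrow> complex \<Rightarrow> complex" where
  "mob u b z = (u * z + b) / (1 + cnj b * u * z)"

text \<open>Recovers \<open>u\<close>: with \<open>b = g 0\<close>, the map taking \<open>w\<close>
  to \<open>(w - b) / (1 - cnj b * w)\<close> sends \<open>g z\<close> to \<open>u * z\<close>; this
  is evaluated at \<open>z = 1/2\<close> and doubled. Using only two point values makes it
  continuous for pointwise convergence.\<close>

definition rot :: "(complex \<Rightarrow> complex) \<Rightarrow> complex" where
  "rot g = 2 * (g (1/2) - g 0) / (1 - cnj (g 0) * g (1/2))"

lemma norm_cnj_mult_less_1:
  assumes "cmod u = 1" "cmod b < 1" "cmod z < 1"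
  shows "cmod (cnj b * u * z) < 1"
proof -
  have "cmod b * cmod z < 1 * 1" using assms by (intro mult_strict_mono') auto
  then show ?thesis using assms by (simp add: norm_mult)
qed

lemma Re_mob_denominator_pos:
  assumes "cmod u = 1" "cmod b < 1" "cmod z < 1"
  shows "0 < Re (1 + cnj b * u * z)"
proof -
  define x where "x = cnj b * u * z"
  have "cmod x < 1" using norm_cnj_mult_less_1[OF assms] by (simp add: x_def)
  then have "0 < Re (1 + x)" using abs_Re_le_cmod[of x] by simp
  then show ?thesis by (simp only: x_def)
qed

lemma mob_denominator_nonzero:
  assumes "cmod u = 1" "cmod b < 1" "cmod z < 1"
  shows "1 + cnj b * u * z \<noteq> 0"
  using Re_mob_denominator_pos[OF assms] by force

lemma one_minus_cmod_sq_nonzero: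
  assumes "cmod b < 1" shows "1 - of_real ((cmod b)\<^sup>2) \<noteq> (0::complex)" "0 < 1 - (cmod b)\<^sup>2"
proof -
  show p: "0 < 1 - (cmod b)\<^sup>2" using assms by (simp add: power_less_one_iff abs_square_less_1)
  have "1 - of_real ((cmod b)\<^sup>2) = complex_of_real (1 - (cmod b)\<^sup>2)" by simp
  then show "1 - of_real ((cmod b)\<^sup>2) \<noteq> (0::complex)" using p by (metis of_real_eq_0_iff less_irrefl)
qed

lemma mob_0 [simp]: "mob u b 0 = b" by (simp add: mob_def)

lemma rot_mob:
  assumes "cmod u = 1" "cmod b < 1"
  shows "2 * (mob u b (1/2) - b) / (1 - cnj b * mob u b (1/2)) = u"
proof -
  let ?d = "1 + cnj b * u * (1/2)"
  have d: "?d \<noteq> 0" using mob_denominator_nonzero[OF assms, of "1/2"] by simp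
  have b: "b * cnj b = of_real ((cmod b)\<^sup>2)" by (metis complex_norm_square)
  have "mob u b (1/2) - b = (u/2 + b - b * ?d) / ?d"
    unfolding mob_def using d by (simp add: diff_divide_distrib)
  also have "u/2 + b - b * ?d = (u/2) * (1 - b * cnj b)" by (simp add: algebra_simps)
  finally have 1: "mob u b (1/2) - b = (u/2) * (1 - of_real ((cmod b)\<^sup>2)) / ?d" unfolding b .
  have "1 - cnj b * mob u b (1/2) = (?d - cnj b * (u/2 + b)) / ?d"
    unfolding mob_def using d by (simp add: diff_divide_distrib)
  also have "?d - cnj b * (u/2 + b) = 1 - b * cnj b" by (simp add: algebra_simps)
  finally have 2: "1 - cnj b * mob u b (1/2) = (1 - of_real ((cmod b)\<^sup>2)) / ?d" unfolding b .
  show ?thesis unfolding 1 2 using d one_minus_cmod_sq_nonzero(1)[OF assms(2)]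
    by (simp del: of_real_power add: divide_simps)
qed

lemma moebius_group_eq:
  "moebius_group = {restrict (mob u b) disc | u b. cmod u = 1 \<and> cmod b < 1}"
proof (intro equalityI subsetI)
  fix g assume "g \<in> moebius_group"
  then obtain a b where ab: "(cmod a)\<^sup>2 - (cmod b)\<^sup>2 = 1"
      "g = restrict (\<lambda>z. (a * z + b) / (cnj b * z + cnj a)) disc"
    unfolding moebius_group_def by blast
  have less: "(cmod b)\<^sup>2 < (cmod a)\<^sup>2" using ab(1) by linarith
  then have a0: "a \<noteq> 0" by auto
  let ?u = "a / cnj a" and ?b = "b / cnj a"
  have "cmod ?u = 1" using a0 by (simp add: norm_divide)
  moreover have "cmod ?b < 1"
    using power2_less_imp_less[OF less] a0 by (simp add: norm_divide divide_less_eq)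
  moreover have "(a * z + b) / (cnj b * z + cnj a) = mob ?u ?b z" for z
  proof -
    have "?u * z + ?b = (a * z + b) / cnj a" by (simp add: add_divide_distrib)
    moreover have "1 + cnj ?b * ?u * z = (cnj b * z + cnj a) / cnj a"
      using a0 by (simp add: add_divide_distrib)
    ultimately show ?thesis unfolding mob_def using a0 by simp
  qed
  ultimately show "g \<in> {restrict (mob u b) disc | u b. cmod u = 1 \<and> cmod b < 1}"
    using ab(2) by auto
next
  fix g assume "g \<in> {restrict (mob u b) disc | u b. cmod u = 1 \<and> cmod b < 1}"
  then obtain u b where ub: "cmod u = 1" "cmod b < 1" "g = restrict (mob u b) disc" by blast
  \<comment> \<open>Inverting the parametrisation: \<open>a\<close> must be a square root of
    \<open>u\<close>, scaled by \<open>1 / s\<close> to meet the determinant condition, and then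
    \<open>c = b * cnj a\<close>.\<close>
  define s where "s = sqrt (1 - (cmod b)\<^sup>2)"
  have s: "0 < s" "s\<^sup>2 = 1 - (cmod b)\<^sup>2" using one_minus_cmod_sq_nonzero(2)[OF ub(2)] by (auto simp: s_def)
  define r where "r = csqrt u"
  have r: "r\<^sup>2 = u" "cmod r = 1" using ub(1) by (auto simp: r_def)
  have rr: "r * cnj r = 1" using r(2) complex_norm_square[of r] by simp
  have r0: "r \<noteq> 0" using r(2) by auto
  define a c where "a = r / of_real s" and "c = b * cnj a"
  have ca: "cmod a = 1 / s" using r(2) s(1) by (simp add: a_def norm_divide)
  have "(cmod a)\<^sup>2 - (cmod c)\<^sup>2 = (1/s)\<^sup>2 * (1 - (cmod b)\<^sup>2)"
    by (simp add: c_def norm_mult ca power_mult_distrib power_divide algebra_simps diff_divide_distrib)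
  also have "\<dots> = 1" unfolding s(2)[symmetric] using s(1) by (simp add: power_divide)
  finally have 1: "(cmod a)\<^sup>2 - (cmod c)\<^sup>2 = 1" .
  have a0: "a \<noteq> 0" using ca s(1) by auto
  have acu: "a = u * cnj a"
  proof -
    have "u * cnj r = r * (r * cnj r)" unfolding r(1)[symmetric] power2_eq_square by (simp only: mult.assoc)
    then have "u * cnj r = r" unfolding rr by simp
    then show ?thesis by (simp add: a_def)
  qed
  have "mob u b z = (a * z + c) / (cnj c * z + cnj a)" for z
  proof -
    have n: "a * z + c = cnj a * (u * z + b)" unfolding c_def by (subst acu) (simp add: algebra_simps)
    have d: "cnj c * z + cnj a = cnj a * (1 + cnj b * u * z)"
      unfolding c_def complex_cnj_mult complex_cnj_cnj by (subst acu) (simp add: algebra_simps)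
    show ?thesis unfolding mob_def n d using a0 by simp
  qed
  then have "g = restrict (\<lambda>z. (a * z + c) / (cnj c * z + cnj a)) disc" using ub(3) by auto
  then show "g \<in> moebius_group" unfolding moebius_group_def using 1 by blast
qed

lemma moebius_groupE:
  assumes "g \<in> moebius_group"
  shows "cmod (rot g) = 1" "cmod (g 0) < 1" "\<And>z. z \<in> disc \<Longrightarrow> g z = mob (rot g) (g 0) z"
    "g = restrict (mob (rot g) (g 0)) disc"
proof -
  obtain u b where ub: "cmod u = 1" "cmod b < 1" "g = restrict (mob u b) disc"
    using assms unfolding moebius_group_eq by blast
  have b: "g 0 = b" and h: "g (1/2) = mob u b (1/2)" using ub(3) by auto
  have u: "rot g = u" unfolding rot_def b h using rot_mob[OF ub(1,2)] by simp
  show "cmod (rot g) = 1" "cmod (g 0) < 1" "\<And>z. z \<in> disc \<Longrightarrow> g z = mob (rot g) (g 0) z"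
    "g = restrict (mob (rot g) (g 0)) disc"
    using ub b u by auto
qed

lemma rot_denominator_nonzero:
  assumes "g \<in> moebius_group"
  shows "1 - cnj (g 0) * g (1/2) \<noteq> 0"
proof
  assume "1 - cnj (g 0) * g (1/2) = 0"
  then have "rot g = 0" by (simp add: rot_def)
  then show False using moebius_groupE(1)[OF assms] by simp
qed

lemma continuous_on_rot: "continuous_on moebius_group rot"
proof -
  have c: "continuous_on moebius_group (\<lambda>g. g z)" for z :: complex
    by (rule continuous_on_subset[OF continuous_on_product_coordinates]) simp
  show ?thesis unfolding rot_def
    by (intro continuous_on_divide continuous_on_mult continuous_on_diff continuous_on_const
        continuous_on_cnj c ballI rot_denominator_nonzero)
qed

text \<open>The group thereby inherits local path-connectedness from a circle and a disc. Its
  topology is pointwise convergence, so continuity of the inverse map is checked one argument at a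
  time; off the disc the value is constantly \<open>undefined\<close>.\<close>

lemma homeomorphism_moebius_group:
  "homeomorphism moebius_group (sphere 0 1 \<times> disc) (\<lambda>g. (rot g, g 0))
     (\<lambda>(u, b). restrict (mob u b) disc)"
proof (rule homeomorphismI)
  have "continuous_on moebius_group (\<lambda>g. g z)" for z :: complex
    by (rule continuous_on_subset[OF continuous_on_product_coordinates]) simp
  then show "continuous_on moebius_group (\<lambda>g. (rot g, g 0))"
    by (intro continuous_intros continuous_on_rot)
  show "continuous_on (sphere 0 1 \<times> disc) (\<lambda>(u, b). restrict (mob u b) disc)"
  proof (rule continuous_on_coordinatewise_then_product)
    fix z :: complex
    show "continuous_on (sphere 0 1 \<times> disc) (\<lambda>x. (case x of (u, b) \<Rightarrow> restrict (mob u b) disc) z)"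
    proof (cases "z \<in> disc")
      case True
      have "continuous_on (sphere 0 1 \<times> disc) (\<lambda>x. mob (fst x) (snd x) z)"
        unfolding mob_def
      proof (intro continuous_intros ballI)
        fix x :: "complex \<times> complex" assume "x \<in> sphere 0 1 \<times> disc"
        then show "1 + cnj (snd x) * fst x * z \<noteq> 0"
          using True by (intro mob_denominator_nonzero) auto
      qed
      then show ?thesis using True by (simp add: case_prod_unfold)
    next
      case False
      then show ?thesis by (simp add: case_prod_unfold)
    qed
  qed
  show "(\<lambda>g. (rot g, g 0)) ` moebius_group \<subseteq> sphere 0 1 \<times> disc"
    using moebius_groupE by auto
  show "(\<lambda>(u, b). restrict (mob u b) disc) ` (sphere 0 1 \<times> disc) \<subseteq> moebius_group"
    unfolding moebius_group_eq by (force simp: image_subset_iff)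
  show "(case (rot g, g 0) of (u, b) \<Rightarrow> restrict (mob u b) disc) = g" if "g \<in> moebius_group" for g
    using moebius_groupE(4)[OF that] by simp
  show "(\<lambda>g. (rot g, g 0)) (case y of (u, b) \<Rightarrow> restrict (mob u b) disc) = y"
    if "y \<in> sphere 0 1 \<times> disc" for y
    using that rot_mob by (auto simp: rot_def)
qed

lemma locally_path_connected_moebius_group: "locally path_connected moebius_group"
proof -
  have "locally path_connected (sphere (0::complex) 1)" by (rule locally_path_connected_sphere)
  moreover have "locally path_connected (disc)" by (intro open_imp_locally_path_connected) auto
  ultimately have S: "locally path_connected (sphere (0::complex) 1 \<times> disc)"
    by (rule locally_Times) (auto intro: path_connected_Times)
  show ?thesis
    by (rule locally_path_connected_local_homeomorphism[OF S])
      (use homeomorphism_moebius_group in \<open>auto intro: openin_subtopology_self\<close>)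
qed

lemma mob_deriv:
  assumes "cmod u = 1" "cmod b < 1" "cmod z < 1"
  shows "(mob u b has_field_derivative u * (1 - of_real ((cmod b)\<^sup>2)) / (1 + cnj b * u * z)\<^sup>2) (at z)"
proof -
  have d: "1 + cnj b * u * z \<noteq> 0" using mob_denominator_nonzero[OF assms] .
  have b: "of_real ((cmod b)\<^sup>2) = b * cnj b" by (metis complex_norm_square)
  have "((\<lambda>z. u * z + b) has_field_derivative u) (at z)"
    by (auto intro!: derivative_eq_intros)
  moreover have "((\<lambda>z. 1 + cnj b * u * z) has_field_derivative cnj b * u) (at z)"
    by (auto intro!: derivative_eq_intros)
  ultimately have "(mob u b has_field_derivative
      (u * (1 + cnj b * u * z) - (u * z + b) * (cnj b * u)) / ((1 + cnj b * u * z) * (1 + cnj b * u * z))) (at z)"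
    unfolding mob_def by (rule DERIV_divide) (rule d)
  moreover have "u * (1 + cnj b * u * z) - (u * z + b) * (cnj b * u) = u * (1 - b * cnj b)"
    by (simp add: algebra_simps)
  ultimately show ?thesis by (simp only: b power2_eq_square[of "1 + _"])
qed

text \<open>Polarised form of \<open>1 - |g z|\<^sup>2 = (1 - |z|\<^sup>2) |g' z|\<close>.\<close>

lemma mob_kernel_identity:
  assumes "cmod u = 1" "cmod b < 1" "cmod z < 1" "cmod w < 1"
  shows "1 - mob u b z * cnj (mob u b w) =
     (1 - of_real ((cmod b)\<^sup>2)) * (1 - z * cnj w) / ((1 + cnj b * u * z) * cnj (1 + cnj b * u * w))"
proof -
  let ?d = "1 + cnj b * u * z" and ?e = "cnj (1 + cnj b * u * w)"
  have d: "?d \<noteq> 0" using mob_denominator_nonzero assms by blast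
  have e: "?e \<noteq> 0" using mob_denominator_nonzero[OF assms(1,2,4)] by (simp only: complex_cnj_zero_iff not_False_eq_True)
  have b: "of_real ((cmod b)\<^sup>2) = b * cnj b" by (metis complex_norm_square)
  have u: "u * cnj u = 1" using assms(1) complex_norm_square[of u] by simp
  have "mob u b z * cnj (mob u b w) = (u * z + b) * (cnj u * cnj w + cnj b) / (?d * ?e)"
    by (simp add: mob_def)
  moreover have "?d * ?e - (u * z + b) * (cnj u * cnj w + cnj b) = (1 - b * cnj b) * (1 - z * cnj w)"
  proof -
    have "?d * ?e - (u * z + b) * (cnj u * cnj w + cnj b) =
        1 - b * cnj b + (u * cnj u) * (b * cnj b - 1) * (z * cnj w)"
      by (simp add: algebra_simps)
    then show ?thesis unfolding u by (simp add: algebra_simps)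
  qed
  moreover have "1 - x / (?d * ?e) = (?d * ?e - x) / (?d * ?e)" for x
    using d e by (simp only: diff_divide_distrib divide_self mult_eq_0_iff simp_thms)
  ultimately show ?thesis by (simp only: b)
qed

subsection \<open>The logarithm of the derivative\<close>

locale moebius_cover =
  fixes Gt :: "('g::topological_space) monoid" and act :: "'g \<Rightarrow> complex \<Rightarrow> complex"
  assumes ucg: "universal_covering_group Gt act"
begin

abbreviation "G \<equiv> carrier Gt"
abbreviation "bc g \<equiv> act g 0"
abbreviation "uc g \<equiv> rot (act g)"

lemma group_Gt: "group Gt" using ucg by (simp add: universal_covering_group_def)

sublocale group Gt by (rule group_Gt)

lemma act_hom: "act \<in> hom Gt (BijGroup disc)"
  using ucg by (simp add: universal_covering_group_def)

lemma act_in_moebius_group: "g \<in> G \<Longrightarrow> act g \<in> moebius_group"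
  using ucg covering_space_imp_surjective unfolding universal_covering_group_def by blast

lemma continuous_on_act: "continuous_on G act"
  using ucg by (simp add: universal_covering_group_def covering_space_def)

lemma act_Bij: "g \<in> G \<Longrightarrow> act g \<in> Bij disc"
  using hom_in_carrier[OF act_hom] by (simp add: BijGroup_def)

lemma act_disc: "g \<in> G \<Longrightarrow> z \<in> disc \<Longrightarrow> act g z \<in> disc"
  using act_Bij by (metis Bij_imp_funcset PiE)

lemma act_mult:
  assumes "g \<in> G" "h \<in> G" "z \<in> disc"
  shows "act (g \<otimes>\<^bsub>Gt\<^esub> h) z = act g (act h z)"
  using hom_mult[OF act_hom assms(1,2)] act_Bij assms by (simp add: BijGroup_def compose_def)

lemma act_one: "z \<in> disc \<Longrightarrow> act \<one>\<^bsub>Gt\<^esub> z = z"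
  using hom_one[OF act_hom group_Gt group_BijGroup] by (simp add: BijGroup_def)

lemma bc_less_1: "g \<in> G \<Longrightarrow> cmod (bc g) < 1" and norm_uc: "g \<in> G \<Longrightarrow> cmod (uc g) = 1"
  using moebius_groupE act_in_moebius_group by blast+

lemma cmod_bc_sq_less_1: "g \<in> G \<Longrightarrow> (cmod (bc g))\<^sup>2 < 1"
  using one_minus_cmod_sq_nonzero(2)[OF bc_less_1, of g] by simp

lemma act_eq_mob: "g \<in> G \<Longrightarrow> z \<in> disc \<Longrightarrow> act g z = mob (uc g) (bc g) z"
  using moebius_groupE(3) act_in_moebius_group by blast

lemma denominator_pos: "g \<in> G \<Longrightarrow> z \<in> disc \<Longrightarrow> 0 < Re (1 + cnj (bc g) * uc g * z)"
  using Re_mob_denominator_pos[OF norm_uc bc_less_1, of g g z] by simp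

lemma denominator_nonzero: "g \<in> G \<Longrightarrow> z \<in> disc \<Longrightarrow> 1 + cnj (bc g) * uc g * z \<noteq> 0"
  using denominator_pos[of g z] by force

lemma denominator_nonpos: "g \<in> G \<Longrightarrow> z \<in> disc \<Longrightarrow> 1 + cnj (bc g) * uc g * z \<notin> \<real>\<^sub>\<le>\<^sub>0"
  using denominator_pos[of g z] by (auto simp: complex_nonpos_Reals_iff)

lemma continuous_on_bc: "continuous_on G bc"
proof -
  have "continuous_on UNIV (\<lambda>f::complex \<Rightarrow> complex. f 0)" by (rule continuous_on_product_coordinates)
  then show ?thesis using continuous_on_compose2[OF _ continuous_on_act] by blast
qed

lemma continuous_on_uc: "continuous_on G uc"
  using continuous_on_compose2[OF continuous_on_rot continuous_on_act] act_in_moebius_group by blast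

lemma continuous_on_act_disc: "continuous_on (G \<times> disc) (\<lambda>(g, z). act g z)"
proof -
  have "continuous_on (G \<times> disc) (\<lambda>x. mob (uc (fst x)) (bc (fst x)) (snd x))"
    unfolding mob_def
    by (intro continuous_intros continuous_on_compose2[OF continuous_on_uc]
        continuous_on_compose2[OF continuous_on_bc]) (auto dest: denominator_nonzero)
  then show ?thesis
    by (rule continuous_on_eq) (auto intro!: act_eq_mob[symmetric])
qed

lemma continuous_on_act_compose:
  assumes "continuous_on S f" "continuous_on S k" "\<And>x. x \<in> S \<Longrightarrow> f x \<in> G" "\<And>x. x \<in> S \<Longrightarrow> k x \<in> disc"
  shows "continuous_on S (\<lambda>x. act (f x) (k x))"
proof -
  have "(\<lambda>x. (f x, k x)) ` S \<subseteq> G \<times> disc" using assms(3,4) by blast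
  from continuous_on_compose2[OF continuous_on_act_disc continuous_on_Pair[OF assms(1,2)] this]
  show ?thesis by simp
qed

lemma simply_connected_G: "simply_connected G"
  using ucg by (simp add: universal_covering_group_def)

lemma connected_G: "connected G"
  using simply_connected_G simply_connected_path_connected path_connected_imp_connected by blast

lemma locally_path_connected_G: "locally path_connected G"
proof (rule locally_path_connected_local_homeomorphism[OF locally_path_connected_moebius_group])
  fix x assume "x \<in> G"
  then show "\<exists>T u p q. x \<in> T \<and> openin (top_of_set G) T \<and> openin (top_of_set moebius_group) u \<and>
      homeomorphism T u p q"
    using ucg covering_space_local_homeomorphism[of G act moebius_group x]
    unfolding universal_covering_group_def by metis
qed

lemma bc_one: "bc \<one>\<^bsub>Gt\<^esub> = 0" and uc_one: "uc \<one>\<^bsub>Gt\<^esub> = 1"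
  using act_one[of 0] act_one[of "1/2"] by (auto simp: rot_def mult.commute)

text \<open>Passing to the cover is what allows this choice: on the Moebius group itself
  \<open>rot\<close> winds once around the circle along the rotations and has no continuous
  logarithm. The value at the identity fixes the branch.\<close>

definition theta :: "'g \<Rightarrow> complex" where
  "theta = (SOME t. continuous_on G t \<and> t \<one>\<^bsub>Gt\<^esub> = 0 \<and> (\<forall>g\<in>G. uc g = exp (t g)))"

lemma theta: "continuous_on G theta" "theta \<one>\<^bsub>Gt\<^esub> = 0" "\<And>g. g \<in> G \<Longrightarrow> exp (theta g) = uc g"
proof -
  have nz: "uc g \<noteq> 0" if "g \<in> G" for g using norm_uc[OF that] by force
  obtain t where "continuous_on G t" "t \<one>\<^bsub>Gt\<^esub> = 0" "\<And>g. g \<in> G \<Longrightarrow> uc g = exp (t g)"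
    using continuous_logarithm_simply_connected[OF continuous_on_uc simply_connected_G
      locally_path_connected_G nz one_closed uc_one] by metis
  then have "\<exists>t. continuous_on G t \<and> t \<one>\<^bsub>Gt\<^esub> = 0 \<and> (\<forall>g\<in>G. uc g = exp (t g))" by blast
  from someI_ex[OF this] show "continuous_on G theta" "theta \<one>\<^bsub>Gt\<^esub> = 0"
    "\<And>g. g \<in> G \<Longrightarrow> exp (theta g) = uc g" unfolding theta_def[symmetric] by auto
qed

lemma Re_theta: "g \<in> G \<Longrightarrow> Re (theta g) = 0"
  using norm_uc[of g] theta(3)[of g] by (metis norm_exp_eq_Re exp_eq_one_iff)

text \<open>A logarithm, factor by factor, of the derivative computed in \<open>mob_deriv\<close>.
  Only \<open>u\<close> requires a lift: the factor \<open>1 - |b|^2\<close> is positive, and the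
  denominator has positive real part on the disc, so its principal logarithm is continuous in
  \<open>g\<close> and \<open>z\<close> together.\<close>

definition logd :: "'g \<Rightarrow> complex \<Rightarrow> complex" where
  "logd g z = theta g + of_real (ln (1 - (cmod (bc g))\<^sup>2)) - 2 * Ln (1 + cnj (bc g) * uc g * z)"

lemma continuous_on_logd: "continuous_on (G \<times> disc) (\<lambda>(g, z). logd g z)"
proof -
  let ?S = "G \<times> disc"
  have t: "continuous_on ?S (\<lambda>x. theta (fst x))"
    by (rule continuous_on_compose2[OF theta(1)]) (auto intro: continuous_intros)
  have b: "continuous_on ?S (\<lambda>x. bc (fst x))"
    by (rule continuous_on_compose2[OF continuous_on_bc]) (auto intro: continuous_intros)
  have u: "continuous_on ?S (\<lambda>x. uc (fst x))"
    by (rule continuous_on_compose2[OF continuous_on_uc]) (auto intro: continuous_intros)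
  have l: "continuous_on ?S (\<lambda>x. ln (1 - (cmod (bc (fst x)))\<^sup>2))"
    by (intro continuous_on_ln continuous_intros b) (use cmod_bc_sq_less_1 in force)
  have d: "continuous_on ?S (\<lambda>x. Ln (1 + cnj (bc (fst x)) * uc (fst x) * snd x))"
    by (intro continuous_on_Ln' continuous_on_add continuous_on_mult continuous_on_cnj
        continuous_on_const continuous_on_snd continuous_on_id b u)
      (auto simp: denominator_nonpos)
  show ?thesis unfolding logd_def case_prod_unfold
    by (intro continuous_on_add continuous_on_diff continuous_on_mult continuous_on_of_real
        continuous_on_const t l d)
qed

lemma continuous_on_logd_compose:
  assumes "continuous_on S f" "continuous_on S k" "\<And>x. x \<in> S \<Longrightarrow> f x \<in> G" "\<And>x. x \<in> S \<Longrightarrow> k x \<in> disc"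
  shows "continuous_on S (\<lambda>x. logd (f x) (k x))"
proof -
  have "(\<lambda>x. (f x, k x)) ` S \<subseteq> G \<times> disc" using assms(3,4) by blast
  from continuous_on_compose2[OF continuous_on_logd continuous_on_Pair[OF assms(1,2)] this]
  show ?thesis by simp
qed

lemma logd_one: "logd \<one>\<^bsub>Gt\<^esub> z = 0" if "z \<in> disc"
  by (simp add: logd_def theta bc_one)

lemma act_deriv:
  assumes "g \<in> G" "z \<in> disc"
  shows "(act g has_field_derivative exp (logd g z)) (at z)"
proof -
  define r where "r = 1 - (cmod (bc g))\<^sup>2"
  have r: "0 < r" using cmod_bc_sq_less_1[OF assms(1)] by (simp add: r_def)
  define w where "w = 1 + cnj (bc g) * uc g * z"
  have "exp (complex_of_real (ln r)) = of_real r"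
    using r by (simp only: exp_of_real exp_ln)
  moreover have "exp (2 * Ln w) = w\<^sup>2"
    using denominator_nonzero[OF assms] by (simp add: exp_double w_def)
  moreover have "exp (logd g z) = exp (theta g) * exp (complex_of_real (ln r)) / exp (2 * Ln w)"
    by (simp only: logd_def exp_diff exp_add r_def w_def)
  ultimately have "exp (logd g z) = uc g * (1 - of_real ((cmod (bc g))\<^sup>2)) / (1 + cnj (bc g) * uc g * z)\<^sup>2"
    by (simp only: theta(3)[OF assms(1)] r_def w_def of_real_diff of_real_1)
  then have "(mob (uc g) (bc g) has_field_derivative exp (logd g z)) (at z)"
    using mob_deriv[OF norm_uc bc_less_1, of g g z] assms by simp
  then show ?thesis
    by (rule has_field_derivative_transform_within_open[of _ _ _ disc])
      (use assms in \<open>auto intro!: act_eq_mob[symmetric]\<close>)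
qed

text \<open>\<open>logd g\<close> has derivative
  \<open>- 2 * cnj b * u / (1 + cnj b * u * z)\<close>, and \<open>exp (logd g z / 2)\<close> has
  the same denominator. Their quotient is free of \<open>z\<close>; divided by -2 it is this
  constant. Up to sign it is the entry \<open>cnj b\<close> of a matrix defining
  \<open>act g\<close> in \<open>moebius_group\<close>.\<close>

definition cc :: "'g \<Rightarrow> complex" where
  "cc g = cnj (bc g) * uc g * exp (- theta g / 2) / of_real (sqrt (1 - (cmod (bc g))\<^sup>2))"

lemma exp_half_logd:
  assumes "g \<in> G" "z \<in> disc"
  shows "exp (logd g z / 2) = exp (theta g / 2) * of_real (sqrt (1 - (cmod (bc g))\<^sup>2)) / (1 + cnj (bc g) * uc g * z)"
proof -
  have p: "0 < 1 - (cmod (bc g))\<^sup>2" using one_minus_cmod_sq_nonzero(2)[OF bc_less_1[OF assms(1)]] .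
  define r where "r = 1 - (cmod (bc g))\<^sup>2"
  have r: "0 < r" using p by (simp add: r_def)
  have "exp (ln r / 2) = sqrt r" using r by (simp add: ln_sqrt[symmetric])
  then have "exp (complex_of_real (ln r / 2)) = of_real (sqrt r)" by (simp only: exp_of_real)
  then have "exp (complex_of_real (ln r) / 2) = of_real (sqrt r)" by simp
  moreover have "logd g z / 2 = theta g / 2 + complex_of_real (ln r) / 2 - Ln (1 + cnj (bc g) * uc g * z)"
    by (simp add: logd_def r_def diff_divide_distrib add_divide_distrib)
  ultimately have "exp (logd g z / 2) =
      exp (theta g / 2) * of_real (sqrt r) / exp (Ln (1 + cnj (bc g) * uc g * z))"
    by (simp only: exp_diff exp_add)
  then show ?thesis
    by (simp only: exp_Ln[OF denominator_nonzero[OF assms]] r_def)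
qed

lemma logd_deriv:
  assumes "g \<in> G" "z \<in> disc"
  shows "(logd g has_field_derivative - 2 * cc g * exp (logd g z / 2)) (at z)"
proof -
  have p: "0 < sqrt (1 - (cmod (bc g))\<^sup>2)" using one_minus_cmod_sq_nonzero(2)[OF bc_less_1[OF assms(1)]] by simp
  have "cc g * exp (logd g z / 2) = cnj (bc g) * uc g / (1 + cnj (bc g) * uc g * z)"
    unfolding exp_half_logd[OF assms] cc_def
    using p by (simp add: exp_minus)
  moreover have "(logd g has_field_derivative - 2 * (cnj (bc g) * uc g / (1 + cnj (bc g) * uc g * z))) (at z)"
  proof -
    have "((\<lambda>z. 1 + cnj (bc g) * uc g * z) has_field_derivative cnj (bc g) * uc g) (at z)"
      by (auto intro!: derivative_eq_intros)
    from DERIV_chain2[OF has_field_derivative_Ln[OF denominator_nonpos[OF assms]] this]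
    have "((\<lambda>z. Ln (1 + cnj (bc g) * uc g * z)) has_field_derivative
        inverse (1 + cnj (bc g) * uc g * z) * (cnj (bc g) * uc g)) (at z)" .
    from DERIV_diff[OF DERIV_const DERIV_cmult[OF this, of 2]] show ?thesis
      unfolding logd_def by (simp add: field_simps)
  qed
  ultimately show ?thesis by (simp add: mult.assoc)
qed

lemma logd_holomorphic: "g \<in> G \<Longrightarrow> logd g holomorphic_on disc"
  using logd_deriv by (meson holomorphic_on_open open_ball)

lemma deriv_act: "g \<in> G \<Longrightarrow> z \<in> disc \<Longrightarrow> deriv (act g) z = exp (logd g z)"
  using act_deriv DERIV_imp_deriv by blast

lemma deriv_deriv_act:
  assumes "g \<in> G" "z \<in> disc"
  shows "deriv (deriv (act g)) z = - 2 * cc g * exp (3 / 2 * logd g z)"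
proof -
  have "((\<lambda>z. exp (logd g z)) has_field_derivative exp (logd g z) * (- 2 * cc g * exp (logd g z / 2))) (at z)"
    by (rule derivative_eq_intros logd_deriv assms refl)+
  then have "(deriv (act g) has_field_derivative exp (logd g z) * (- 2 * cc g * exp (logd g z / 2))) (at z)"
    by (rule has_field_derivative_transform_within_open[of _ _ _ disc])
      (use assms in \<open>auto simp: deriv_act\<close>)
  moreover have "exp (logd g z) * (- 2 * cc g * exp (logd g z / 2)) = - 2 * cc g * exp (3 / 2 * logd g z)"
  proof -
    have "3 / 2 * logd g z = logd g z + logd g z / 2" by simp
    then show ?thesis by (simp only: exp_add mult_ac)
  qed
  ultimately show ?thesis by (metis DERIV_imp_deriv)
qed

section \<open>Cocycle identities\<close>

text \<open>By the chain rule the exponentials of both sides agree. Both sides are continuous on the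
  connected set \<open>(G \<times> G) \<times> disc\<close> and vanish at the pair of identities
  with \<open>z = 0\<close>, so no multiple of 2 pi i can separate them.\<close>

lemma logd_mult:
  assumes "g \<in> G" "h \<in> G" "z \<in> disc"
  shows "logd (g \<otimes>\<^bsub>Gt\<^esub> h) z = logd h z + logd g (act h z)"
proof -
  let ?S = "(G \<times> G) \<times> disc"
  let ?l = "\<lambda>((g, h), z). logd (g \<otimes>\<^bsub>Gt\<^esub> h) z" and ?r = "\<lambda>((g, h), z). logd h z + logd g (act h z)"
  have cm: "continuous_on (G \<times> G) (\<lambda>x. fst x \<otimes>\<^bsub>Gt\<^esub> snd x)"
    using ucg by (simp add: universal_covering_group_def case_prod_unfold)
  have cm': "continuous_on ?S (\<lambda>x. fst (fst x) \<otimes>\<^bsub>Gt\<^esub> snd (fst x))"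
    by (rule continuous_on_compose2[OF cm]) (auto intro!: continuous_intros)
  have f: "continuous_on ?S (\<lambda>x. fst (fst x))" "continuous_on ?S (\<lambda>x. snd (fst x))" "continuous_on ?S snd"
    by (intro continuous_intros)+
  have "continuous_on ?S (\<lambda>x. logd (fst (fst x) \<otimes>\<^bsub>Gt\<^esub> snd (fst x)) (snd x))"
    by (rule continuous_on_logd_compose[OF cm' f(3)]) auto
  then have l: "continuous_on ?S ?l" by (simp only: case_prod_unfold)
  have a: "continuous_on ?S (\<lambda>x. act (snd (fst x)) (snd x))"
    by (rule continuous_on_act_compose[OF f(2,3)]) auto
  have r1: "continuous_on ?S (\<lambda>x. logd (snd (fst x)) (snd x))"
    by (rule continuous_on_logd_compose[OF f(2,3)]) auto
  have r2: "continuous_on ?S (\<lambda>x. logd (fst (fst x)) (act (snd (fst x)) (snd x)))"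
    by (rule continuous_on_logd_compose[OF f(1) a]) (use act_disc in \<open>simp_all only: mem_Times_iff\<close>)
  have r: "continuous_on ?S ?r"
    using continuous_on_add[OF r1 r2] by (simp only: case_prod_unfold)
  have e: "exp (logd (g \<otimes>\<^bsub>Gt\<^esub> h) z) = exp (logd h z + logd g (act h z))"
    if "g \<in> G" "h \<in> G" "z \<in> disc" for g h z
  proof -
    have "((\<lambda>z. act g (act h z)) has_field_derivative exp (logd g (act h z)) * exp (logd h z)) (at z)"
      by (rule DERIV_chain2[of "act g"]) (use that act_disc in \<open>auto intro!: act_deriv\<close>)
    then have "(act (g \<otimes>\<^bsub>Gt\<^esub> h) has_field_derivative exp (logd g (act h z)) * exp (logd h z)) (at z)"
      by (rule has_field_derivative_transform_within_open[of _ _ _ disc])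
        (use that in \<open>auto simp: act_mult\<close>)
    then have "exp (logd (g \<otimes>\<^bsub>Gt\<^esub> h) z) = exp (logd g (act h z)) * exp (logd h z)"
      using DERIV_unique act_deriv[of "g \<otimes>\<^bsub>Gt\<^esub> h" z] that by (metis m_closed)
    then show ?thesis by (simp add: exp_add mult.commute)
  qed
  have "connected ?S" by (intro connected_Times connected_G) auto
  then have "?l ((g, h), z) = ?r ((g, h), z)"
    using exp_difference_constant[OF _ l r, of "((\<one>\<^bsub>Gt\<^esub>, \<one>\<^bsub>Gt\<^esub>), 0)" "((g, h), z)"] e assms
    by (auto simp: logd_one act_one)
  then show ?thesis by simp
qed

text \<open>Differentiating the cocycle identity for the logarithm of the derivative.\<close>

lemma cc_mult:
  assumes "g \<in> G" "h \<in> G" "z \<in> disc"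
  shows "cc (g \<otimes>\<^bsub>Gt\<^esub> h) * exp (logd g (act h z) / 2) =
     cc h + cc g * exp (logd g (act h z) / 2) * exp (logd h z / 2)"
proof -
  let ?q = "exp (logd h z / 2)" and ?p = "exp (logd g (act h z) / 2)"
  have gh: "g \<otimes>\<^bsub>Gt\<^esub> h \<in> G" using assms by simp
  have "((\<lambda>z. logd h z + logd g (act h z)) has_field_derivative
      - 2 * cc h * ?q + (- 2 * cc g * ?p) * exp (logd h z)) (at z)"
    by (intro derivative_intros DERIV_chain2[of "logd g"] logd_deriv act_deriv assms act_disc)
  then have "(logd (g \<otimes>\<^bsub>Gt\<^esub> h) has_field_derivative
      - 2 * cc h * ?q + (- 2 * cc g * ?p) * exp (logd h z)) (at z)"
    by (rule has_field_derivative_transform_within_open[of _ _ _ disc])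
      (use assms in \<open>auto simp: logd_mult\<close>)
  then have "- 2 * cc (g \<otimes>\<^bsub>Gt\<^esub> h) * exp (logd (g \<otimes>\<^bsub>Gt\<^esub> h) z / 2) =
      - 2 * cc h * ?q + (- 2 * cc g * ?p) * exp (logd h z)"
    using DERIV_unique logd_deriv[OF gh assms(3)] by blast
  moreover have e1: "exp (logd (g \<otimes>\<^bsub>Gt\<^esub> h) z / 2) = ?q * ?p"
    by (simp add: logd_mult[OF assms] add_divide_distrib exp_add)
  moreover have e2: "exp (logd h z) = ?q * ?q" by (simp add: exp_add[symmetric])
  ultimately have "(-2 * ?q) * (cc (g \<otimes>\<^bsub>Gt\<^esub> h) * ?p) = (-2 * ?q) * (cc h + cc g * ?p * ?q)"
    unfolding e1 e2 by (simp only: algebra_simps)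
  then show ?thesis
    by (simp only: mult_left_cancel[of "-2 * ?q"] mult_eq_0_iff exp_not_eq_zero neg_equal_0_iff_equal
        zero_neq_numeral[symmetric] simp_thms)
qed

section \<open>Identification of \<open>dpow\<close> and \<open>c_const\<close>\<close>

lemma derivative_power_exp_logd:
  "derivative_power Gt act \<alpha> (\<lambda>g z. exp (\<alpha> * logd g z))"
proof -
  \<comment> \<open>The bounds must serve all \<open>z\<close> at once. If \<open>|b| < 1/4\<close>,
    then \<open>|Im (Ln (1 + x))| < 1/2\<close> for \<open>x = cnj b * u * z\<close>, so
    \<open>|Im (logd g z)| < 1 + 2 * (1/2) = 2 \<le> pi\<close> and \<open>logd g z\<close> is the
    principal logarithm.\<close>
  define N where "N = G \<inter> (\<lambda>g. (cmod (bc g), \<bar>Im (theta g)\<bar>)) -` ({..<1/4} \<times> {..<1})"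
  have "continuous_on G (\<lambda>g. (cmod (bc g), \<bar>Im (theta g)\<bar>))"
    by (intro continuous_intros continuous_on_bc theta)
  then have N: "openin (top_of_set G) N" unfolding N_def
    by (rule continuous_openin_preimage_gen) (auto intro: open_Times)
  have N1: "\<one>\<^bsub>Gt\<^esub> \<in> N" by (simp add: N_def bc_one theta)
  have pw: "exp (\<alpha> * logd g z) = deriv (act g) z powr \<alpha>" if g: "g \<in> N" and z: "z \<in> disc" for g z
  proof -
    have gG: "g \<in> G" and bg: "cmod (bc g) < 1/4" and tg: "\<bar>Im (theta g)\<bar> < 1"
      using g by (auto simp: N_def)
    define x where "x = cnj (bc g) * uc g * z"
    have "cmod x = cmod (bc g) * cmod z" by (simp add: x_def norm_mult norm_uc[OF gG])
    also have "\<dots> \<le> cmod (bc g) * 1" using z by (intro mult_left_mono) auto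
    finally have x: "cmod x < 1/4" using bg by simp
    then have "cmod (Ln (1 + x)) \<le> 2 * cmod x" by (intro norm_Ln_le) auto
    then have "\<bar>Im (Ln (1 + x))\<bar> < 1/2" using x abs_Im_le_cmod[of "Ln (1 + x)"] by linarith
    moreover have "Im (logd g z) = Im (theta g) - 2 * Im (Ln (1 + x))"
      by (simp add: logd_def x_def)
    ultimately have "\<bar>Im (logd g z)\<bar> < 2" using tg by linarith
    then have "Ln (exp (logd g z)) = logd g z" using pi_ge_two by (intro Ln_exp) linarith+
    then show ?thesis by (simp add: deriv_act[OF gG z] powr_def)
  qed
  have c: "continuous_on (G \<times> disc) (\<lambda>x. exp (\<alpha> * logd (fst x) (snd x)))"
    by (intro continuous_intros continuous_on_logd_compose) auto
  show ?thesis unfolding derivative_power_def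
  proof (intro conjI ballI)
    show "continuous_on (G \<times> disc) (\<lambda>(g, z). exp (\<alpha> * logd g z))"
      using c by (simp only: case_prod_unfold)
    show "(\<lambda>z. exp (\<alpha> * logd g z)) holomorphic_on disc" if "g \<in> G" for g
      using that by (intro holomorphic_intros logd_holomorphic)
    show "\<exists>w. exp w = deriv (act g) z \<and> exp (\<alpha> * logd g z) = exp (\<alpha> * w)"
      if "g \<in> G" "z \<in> disc" for g z
      using deriv_act[OF that] by metis
    show "\<exists>N. openin (top_of_set G) N \<and> \<one>\<^bsub>Gt\<^esub> \<in> N \<and>
        (\<forall>g\<in>N. \<forall>z\<in>disc. exp (\<alpha> * logd g z) = deriv (act g) z powr \<alpha>)"
      using N N1 pw by blast
  qed
qed

text \<open>The quotient of \<open>P\<close> by \<open>exp (\<alpha> * logd g z)\<close> takes only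
  the countably many values \<open>exp (2 * pi * \<i> * n * \<alpha>)\<close>, so it is constant on
  the connected set \<open>G \<times> disc\<close>; the principal branch at the identity makes the
  constant 1.\<close>

lemma derivative_power_unique:
  assumes P: "derivative_power Gt act \<alpha> P" and gz: "g \<in> G" "z \<in> disc"
  shows "P g z = exp (\<alpha> * logd g z)"
proof -
  let ?S = "G \<times> disc" and ?R = "\<lambda>x. P (fst x) (snd x) * exp (- \<alpha> * logd (fst x) (snd x))"
  have "continuous_on ?S (\<lambda>x. P (fst x) (snd x))"
    using P unfolding derivative_power_def by (simp only: case_prod_unfold)
  then have cR: "continuous_on ?S ?R"
    by (intro continuous_intros continuous_on_logd_compose) auto
  have "?R ` ?S \<subseteq> range (\<lambda>n::int. exp (\<alpha> * ((of_int (2*n) * pi) * \<i>)))"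
  proof clarify
    fix g z assume g: "g \<in> G" and z: "z \<in> disc"
    obtain w where w: "exp w = deriv (act g) z" "P g z = exp (\<alpha> * w)"
      using P g z unfolding derivative_power_def by blast
    then have "exp w = exp (logd g z)" using g z by (simp add: deriv_act)
    then obtain n::int where "w = logd g z + (of_int (2*n) * pi) * \<i>" by (metis exp_eq)
    then have "P g z * exp (- \<alpha> * logd g z) = exp (\<alpha> * ((of_int (2*n) * pi) * \<i>))"
      unfolding w(2) exp_add[symmetric] by (simp add: algebra_simps)
    then show "P (fst (g, z)) (snd (g, z)) * exp (- \<alpha> * logd (fst (g, z)) (snd (g, z)))
        \<in> range (\<lambda>n::int. exp (\<alpha> * ((of_int (2*n) * pi) * \<i>)))"
      by auto
  qed
  then have cnt: "countable (?R ` ?S)" by (meson countable_subset countableI_type countable_image)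
  have conn: "connected ?S" by (intro connected_Times connected_G) auto
  have "(g, z) \<in> ?S" "(\<one>\<^bsub>Gt\<^esub>, 0) \<in> ?S" using gz by auto
  from countable_range_constant[OF conn cR cnt this]
  have "P g z * exp (- \<alpha> * logd g z) = P \<one>\<^bsub>Gt\<^esub> 0 * exp (- \<alpha> * logd \<one>\<^bsub>Gt\<^esub> 0)"
    by (simp only: fst_conv snd_conv)
  also have "\<dots> = 1"
  proof -
    obtain N where "\<one>\<^bsub>Gt\<^esub> \<in> N" "\<forall>g\<in>N. \<forall>z\<in>disc. P g z = deriv (act g) z powr \<alpha>"
      using P unfolding derivative_power_def by blast
    then have "P \<one>\<^bsub>Gt\<^esub> 0 = deriv (act \<one>\<^bsub>Gt\<^esub>) 0 powr \<alpha>" by simp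
    then show ?thesis by (simp add: deriv_act logd_one)
  qed
  finally show ?thesis by (simp add: exp_minus field_simps)
qed

lemma dpow_eq:
  assumes "g \<in> G" "z \<in> disc"
  shows "dpow Gt act \<alpha> g z = exp (\<alpha> * logd g z)"
  unfolding dpow_def
proof (rule the_equality)
  show "\<exists>P. derivative_power Gt act \<alpha> P \<and> exp (\<alpha> * logd g z) = P g z"
    by (intro exI[of _ "\<lambda>g z. exp (\<alpha> * logd g z)"] conjI derivative_power_exp_logd refl)
  show "w = exp (\<alpha> * logd g z)" if "\<exists>P. derivative_power Gt act \<alpha> P \<and> w = P g z" for w
    using that derivative_power_unique[OF _ assms] by auto
qed

lemma c_const_eq:
  assumes "g \<in> G"
  shows "c_const Gt act g = cc g"
  unfolding c_const_def
proof (rule the_equality)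
  show "\<forall>z\<in>disc. deriv (deriv (act g)) z = - 2 * cc g * dpow Gt act (3 / 2) g z"
    using assms by (auto simp: deriv_deriv_act dpow_eq)
next
  fix c assume "\<forall>z\<in>disc. deriv (deriv (act g)) z = - 2 * c * dpow Gt act (3 / 2) g z"
  then have "- 2 * cc g * exp (3 / 2 * logd g 0) = - 2 * c * exp (3 / 2 * logd g 0)"
    using assms deriv_deriv_act[of g 0] dpow_eq[of g 0] by simp
  then show "c = cc g" by simp
qed

lemma continuous_on_cc: "continuous_on G cc"
proof -
  have "sqrt (1 - (cmod (bc g))\<^sup>2) \<noteq> 0" if "g \<in> G" for g
    using cmod_bc_sq_less_1[OF that] by simp
  then show ?thesis unfolding cc_def
    by (intro continuous_intros continuous_on_bc continuous_on_uc theta) auto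
qed

end

subsection \<open>Weighted composition operators on reproducing kernel spaces\<close>

locale kernel_space =
  fixes H :: "complex fun_space" and K :: "complex \<Rightarrow> complex \<Rightarrow> complex"
  assumes hilbert: "holomorphic_hilbert_space H" and kernel: "reproducing_kernel H K"
begin

definition kf :: "complex \<Rightarrow> complex \<Rightarrow> complex" where
  "kf w = (\<lambda>z. if z \<in> disc then K z w else 0)"

lemma kf_in: "w \<in> disc \<Longrightarrow> kf w \<in> carrier H"
  and reproduce: "w \<in> disc \<Longrightarrow> f \<in> carrier H \<Longrightarrow> ip H f (kf w) = f w"
  using kernel unfolding reproducing_kernel_def kf_def by auto

lemma zero_outside: "f \<in> carrier H \<Longrightarrow> z \<notin> disc \<Longrightarrow> f z = 0"
  using hilbert unfolding holomorphic_hilbert_space_def by blast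

lemma zero_in: "(\<lambda>z. 0) \<in> carrier H"
  using hilbert unfolding holomorphic_hilbert_space_def by blast

lemma add_in: "f \<in> carrier H \<Longrightarrow> g \<in> carrier H \<Longrightarrow> (\<lambda>z. f z + g z) \<in> carrier H"
  using hilbert unfolding holomorphic_hilbert_space_def by blast

lemma scale_in: "f \<in> carrier H \<Longrightarrow> (\<lambda>z. c * f z) \<in> carrier H"
  using hilbert unfolding holomorphic_hilbert_space_def by blast

lemma diff_in: "f \<in> carrier H \<Longrightarrow> g \<in> carrier H \<Longrightarrow> (\<lambda>z. f z - g z) \<in> carrier H"
  using add_in[of f "\<lambda>z. (-1) * g z"] scale_in[of g "-1"] by simp

lemma ip_add: "f \<in> carrier H \<Longrightarrow> g \<in> carrier H \<Longrightarrow> h \<in> carrier H \<Longrightarrow>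
    ip H (\<lambda>z. f z + g z) h = ip H f h + ip H g h"
  using hilbert unfolding holomorphic_hilbert_space_def by blast

lemma ip_scale: "f \<in> carrier H \<Longrightarrow> h \<in> carrier H \<Longrightarrow> ip H (\<lambda>z. c * f z) h = c * ip H f h"
  using hilbert unfolding holomorphic_hilbert_space_def by blast

lemma ip_cnj: "f \<in> carrier H \<Longrightarrow> h \<in> carrier H \<Longrightarrow> ip H h f = cnj (ip H f h)"
  using hilbert unfolding holomorphic_hilbert_space_def by blast

lemma norm_sq_pos: "f \<in> carrier H \<Longrightarrow> f \<noteq> (\<lambda>z. 0) \<Longrightarrow> 0 < norm_sq H f"
  using hilbert unfolding holomorphic_hilbert_space_def by blast

lemma complete:
  assumes "\<And>n::nat. x n \<in> carrier H"
    and "\<And>e. e > 0 \<Longrightarrow> \<exists>N. \<forall>i\<ge>N. \<forall>k\<ge>N. norm_sq H (\<lambda>z. x i z - x k z) < e"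
  obtains f where "f \<in> carrier H" "(\<lambda>n. norm_sq H (\<lambda>z. x n z - f z)) \<longlonglongrightarrow> 0"
proof -
  have "\<forall>x. (\<forall>n::nat. x n \<in> carrier H) \<and>
          (\<forall>e>0. \<exists>N. \<forall>i\<ge>N. \<forall>k\<ge>N. norm_sq H (\<lambda>z. x i z - x k z) < e) \<longrightarrow>
          (\<exists>f \<in> carrier H. (\<lambda>n. norm_sq H (\<lambda>z. x n z - f z)) \<longlonglongrightarrow> 0)"
    using hilbert unfolding holomorphic_hilbert_space_def by (elim conjE)
  from this[THEN spec[of _ x]] assms that show thesis by blast
qed

lemma ip_diff:
  assumes "f \<in> carrier H" "g \<in> carrier H" "h \<in> carrier H"
  shows "ip H (\<lambda>z. f z - g z) h = ip H f h - ip H g h"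
  using ip_add[OF assms(1) scale_in[OF assms(2), of "-1"] assms(3)] ip_scale[OF assms(2,3), of "-1"]
  by simp

lemma ip_add_right:
  assumes "f \<in> carrier H" "g \<in> carrier H" "h \<in> carrier H"
  shows "ip H h (\<lambda>z. f z + g z) = ip H h f + ip H h g"
  using ip_cnj[OF add_in[OF assms(1,2)] assms(3)] ip_add[OF assms] ip_cnj[OF assms(1,3)]
    ip_cnj[OF assms(2,3)] by simp

lemma ip_diff_right:
  assumes "f \<in> carrier H" "g \<in> carrier H" "h \<in> carrier H"
  shows "ip H h (\<lambda>z. f z - g z) = ip H h f - ip H h g"
  using ip_cnj[OF diff_in[OF assms(1,2)] assms(3)] ip_diff[OF assms] ip_cnj[OF assms(1,3)]
    ip_cnj[OF assms(2,3)] by simp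

lemma ip_scale_right:
  assumes "f \<in> carrier H" "h \<in> carrier H"
  shows "ip H h (\<lambda>z. c * f z) = cnj c * ip H h f"
  using ip_cnj[OF scale_in[OF assms(1), of c] assms(2)] ip_scale[OF assms, of c] ip_cnj[OF assms] by simp

lemma norm_sq_zero: "norm_sq H (\<lambda>z. 0) = 0"
  using ip_scale[OF zero_in zero_in, of 0] by (simp add: norm_sq_def)

lemma norm_sq_nonneg: "f \<in> carrier H \<Longrightarrow> 0 \<le> norm_sq H f"
  by (cases "f = (\<lambda>z. 0)") (simp_all add: norm_sq_zero norm_sq_pos less_imp_le)

lemma norm_sq_add:
  assumes "f \<in> carrier H" "g \<in> carrier H"
  shows "norm_sq H (\<lambda>z. f z + g z) = norm_sq H f + 2 * Re (ip H f g) + norm_sq H g"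
  unfolding norm_sq_def
  using assms ip_cnj[OF assms] by (simp add: ip_add ip_add_right add_in)

lemma norm_sq_diff:
  assumes "f \<in> carrier H" "g \<in> carrier H"
  shows "norm_sq H (\<lambda>z. f z - g z) = norm_sq H f - 2 * Re (ip H f g) + norm_sq H g"
  unfolding norm_sq_def
  using assms ip_cnj[OF assms] by (simp add: ip_diff ip_diff_right diff_in)

lemma norm_sq_scale:
  assumes "f \<in> carrier H"
  shows "norm_sq H (\<lambda>z. c * f z) = (cmod c)\<^sup>2 * norm_sq H f"
proof -
  have "ip H (\<lambda>z. c * f z) (\<lambda>z. c * f z) = (c * cnj c) * ip H f f"
    using assms by (simp add: ip_scale ip_scale_right scale_in)
  also have "\<dots> = of_real ((cmod c)\<^sup>2) * ip H f f" by (simp only: complex_norm_square)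
  finally show ?thesis unfolding norm_sq_def by (simp del: of_real_power)
qed

text \<open>Subtracting the orthogonal projection onto \<open>kf w\<close>, with coefficient
  \<open>t = h w / norm_sq H (kf w)\<close>, lowers the squared norm by
  \<open>|h w|^2 / norm_sq H (kf w)\<close>, which \<open>near\<close> bounds by \<epsilon>. With
  \<open>\<epsilon> = norm_sq H h\<close> this is Cauchy-Schwarz; with small \<epsilon> it says that
  nearly minimal distance forces small values.\<close>

lemma point_evaluation_bound:
  assumes h: "h \<in> carrier H" and w: "w \<in> disc"
    and near: "\<And>t. norm_sq H h - \<epsilon> \<le> norm_sq H (\<lambda>z. h z - t * kf w z)"
  shows "(cmod (h w))\<^sup>2 \<le> \<epsilon> * norm_sq H (kf w)"
proof (cases "kf w = (\<lambda>z. 0)")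
  case True
  then have "h w = ip H h (\<lambda>z. 0 * 0)" using reproduce[OF w h] by simp
  also have "\<dots> = 0" using ip_scale_right[OF zero_in h, of 0] by simp
  finally show ?thesis using True norm_sq_zero by simp
next
  case False
  define k where "k = norm_sq H (kf w)"
  have k: "0 < k" unfolding k_def by (rule norm_sq_pos[OF kf_in[OF w] False])
  define t where "t = h w / of_real k"
  have "norm_sq H h - \<epsilon> \<le> norm_sq H h - 2 * Re (ip H h (\<lambda>z. t * kf w z)) + norm_sq H (\<lambda>z. t * kf w z)"
    using near[of t] norm_sq_diff[OF h scale_in[OF kf_in[OF w]], of t] by simp
  also have "ip H h (\<lambda>z. t * kf w z) = cnj t * h w"
    using ip_scale_right[OF kf_in[OF w] h] reproduce[OF w h] by simp
  also have "cnj t * h w = of_real ((cmod (h w))\<^sup>2 / k)"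
    unfolding t_def of_real_divide complex_norm_square by (simp add: mult.commute)
  also have "norm_sq H (\<lambda>z. t * kf w z) = (cmod (h w))\<^sup>2 / k"
    unfolding norm_sq_scale[OF kf_in[OF w]] k_def[symmetric]
  proof -
    have "(cmod t)\<^sup>2 = (cmod (h w))\<^sup>2 / k\<^sup>2"
      using k by (simp add: t_def norm_divide power_divide)
    then show "(cmod t)\<^sup>2 * k = (cmod (h w))\<^sup>2 / k" using k by (simp add: power2_eq_square)
  qed
  finally have "(cmod (h w))\<^sup>2 / k \<le> \<epsilon>" by (simp del: of_real_divide of_real_power)
  then show ?thesis using k by (simp add: k_def[symmetric] field_simps)
qed

lemma point_evaluation_norm:
  assumes "h \<in> carrier H" "w \<in> disc"
  shows "(cmod (h w))\<^sup>2 \<le> norm_sq H h * norm_sq H (kf w)"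
  by (rule point_evaluation_bound[OF assms])
    (use norm_sq_nonneg[OF diff_in[OF assms(1) scale_in[OF kf_in[OF assms(2)]]]] in simp)

text \<open>The operator is isometric on the span of the kernel functions; \<open>f\<close> is a pointwise limit of a
  Cauchy sequence in that span, obtained by minimising the distance to \<open>f\<close>.\<close>

lemma weighted_composition_in:
  assumes \<phi>: "\<And>z. z \<in> disc \<Longrightarrow> \<phi> z \<in> disc" "\<And>w. w \<in> disc \<Longrightarrow> \<exists>v\<in>disc. \<phi> v = w"
    and m: "\<And>z. z \<in> disc \<Longrightarrow> m z \<noteq> 0"
    and K: "\<And>z v. z \<in> disc \<Longrightarrow> v \<in> disc \<Longrightarrow> K z v = m z * K (\<phi> z) (\<phi> v) * cnj (m v)"
    and f: "f \<in> carrier H"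
  shows "(\<lambda>z. if z \<in> disc then m z * f (\<phi> z) else 0) \<in> carrier H"
proof -
  define T where "T f = (\<lambda>z. if z \<in> disc then m z * f (\<phi> z) else 0)" for f
  have T_add: "T (\<lambda>z. f z + g z) = (\<lambda>z. T f z + T g z)" for f g
    by (auto simp: T_def algebra_simps)
  have T_scale: "T (\<lambda>z. c * f z) = (\<lambda>z. c * T f z)" for c f
    by (auto simp: T_def)
  have T_diff: "T (\<lambda>z. f z - g z) = (\<lambda>z. T f z - T g z)" for f g
    by (auto simp: T_def algebra_simps)
  \<comment> \<open>\<open>S\<close> stands in for the span of the kernels: a subspace containing
    them, defined by the property to be used, so that no linear combinations have to be written
    down. Testing against all admissible \<open>h\<close> makes closure under linear operations
    immediate from linearity in the first argument; \<open>h = s\<close> gives the isometry.\<close>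
  define S where "S = {s \<in> carrier H. T s \<in> carrier H \<and>
      (\<forall>h \<in> carrier H. T h \<in> carrier H \<longrightarrow> ip H (T s) (T h) = ip H s h)}"
  have S_H: "s \<in> carrier H" and S_T: "T s \<in> carrier H" if "s \<in> S" for s
    using that by (auto simp: S_def)
  have S_norm: "norm_sq H (T s) = norm_sq H s" if "s \<in> S" for s
    using that by (simp add: S_def norm_sq_def)
  have S_add: "(\<lambda>z. s z + t z) \<in> S" if "s \<in> S" "t \<in> S" for s t
    using that unfolding S_def by (auto simp: T_add add_in ip_add)
  have S_scale: "(\<lambda>z. c * s z) \<in> S" if "s \<in> S" for c s
    using that unfolding S_def by (auto simp: T_scale scale_in ip_scale)
  have S_diff: "(\<lambda>z. s z - t z) \<in> S" if "s \<in> S" "t \<in> S" for s t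
    using that unfolding S_def by (auto simp: T_diff diff_in ip_diff)
  have S_kf: "kf w \<in> S" if w: "w \<in> disc" for w
  proof -
    obtain v where v: "v \<in> disc" "\<phi> v = w" using \<phi>(2)[OF w] by blast
    have mv: "m v \<noteq> 0" using m v by blast
    \<comment> \<open>The kernel identity with \<open>\<phi> v = w\<close>, divided by
      \<open>cnj (m v)\<close>.\<close>
    have Tk: "T (kf w) = (\<lambda>z. inverse (cnj (m v)) * kf v z)"
    proof
      fix z show "T (kf w) z = inverse (cnj (m v)) * kf v z"
        using K[of z v] v \<phi>(1)[of z] mv by (auto simp: T_def kf_def)
    qed
    have Tin: "T (kf w) \<in> carrier H" unfolding Tk by (intro scale_in kf_in v)
    have "ip H (T (kf w)) (T h) = ip H (kf w) h" if h: "h \<in> carrier H" "T h \<in> carrier H" for h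
    proof -
      have "ip H (T h) (T (kf w)) = inverse (m v) * T h v"
        unfolding Tk using h v by (simp add: ip_scale_right kf_in reproduce)
      also have "\<dots> = ip H h (kf w)" using h v mv w by (simp add: T_def reproduce)
      finally show ?thesis
        using ip_cnj[OF h(2) Tin] ip_cnj[OF h(1) kf_in[OF w]] by simp
    qed
    then show ?thesis using Tin kf_in[OF w] by (simp add: S_def)
  qed
  define D where "D s = norm_sq H (\<lambda>z. f z - s z)" for s
  define d where "d = Inf (D ` S)"
  have D0: "0 \<le> D s" if "s \<in> S" for s
    unfolding D_def by (intro norm_sq_nonneg diff_in f S_H that)
  have bdd: "bdd_below (D ` S)" using D0 by (intro bdd_belowI[of _ 0]) auto
  have dle: "d \<le> D s" if "s \<in> S" for s
    unfolding d_def using bdd that by (intro cInf_lower) auto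
  have ne: "D ` S \<noteq> {}" using S_kf[of 0] by auto
  have "\<exists>s\<in>S. D s < d + 1 / real (Suc n)" for n
  proof -
    have "Inf (D ` S) < d + 1 / real (Suc n)" by (simp add: d_def[symmetric])
    from cInf_lessD[OF ne this] show ?thesis by blast
  qed
  then obtain s where s: "\<And>n. s n \<in> S" "\<And>n. D (s n) < d + 1 / real (Suc n)" by metis
  \<comment> \<open>Parallelogram law: the midpoint \<open>?c\<close> lies in \<open>S\<close>, so
    its squared distance from \<open>f\<close> is at least \<open>d\<close>, and
    \<open>2 * (d + 1/(i+1)) + 2 * (d + 1/(k+1)) - 4 * d\<close> is the bound.\<close>
  have cauchy: "norm_sq H (\<lambda>z. s i z - s k z) \<le> 2 / real (Suc i) + 2 / real (Suc k)" for i k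
  proof -
    let ?a = "\<lambda>z. f z - s i z" and ?b = "\<lambda>z. f z - s k z"
    let ?c = "\<lambda>z. (1/2) * (s i z + s k z)"
    have ab: "?a \<in> carrier H" "?b \<in> carrier H" using s(1) S_H f diff_in by auto
    have c: "?c \<in> S" by (rule S_scale[OF S_add[OF s(1) s(1)]])
    have fc: "(\<lambda>z. f z - ?c z) \<in> carrier H" by (intro diff_in f S_H c)
    have "norm_sq H (\<lambda>z. ?b z - ?a z) = 2 * D (s i) + 2 * D (s k) - norm_sq H (\<lambda>z. ?b z + ?a z)"
      unfolding norm_sq_diff[OF ab(2,1)] norm_sq_add[OF ab(2,1)] D_def by simp
    moreover have "(\<lambda>z. ?b z + ?a z) = (\<lambda>z. 2 * (f z - ?c z))" by (auto simp: algebra_simps)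
    then have "norm_sq H (\<lambda>z. ?b z + ?a z) = 4 * D ?c"
      by (simp only: norm_sq_scale[OF fc]) (simp add: D_def)
    moreover have "(\<lambda>z. ?b z - ?a z) = (\<lambda>z. s i z - s k z)" by auto
    ultimately have "norm_sq H (\<lambda>z. s i z - s k z) = 2 * D (s i) + 2 * D (s k) - 4 * D ?c" by simp
    moreover have "2 / real (Suc i) = 2 * (1 / real (Suc i))" "2 / real (Suc k) = 2 * (1 / real (Suc k))"
      by simp_all
    ultimately show ?thesis using s(2)[of i] s(2)[of k] dle[OF c] by linarith
  qed
  have C: "\<exists>N. \<forall>i\<ge>N. \<forall>k\<ge>N. norm_sq H (\<lambda>z. T (s i) z - T (s k) z) < e" if "e > 0" for e
  proof -
    have "0 < e / 4" using that by simp
    from reals_Archimedean[OF this] obtain N where N: "inverse (real (Suc N)) < e / 4" by blast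
    have "norm_sq H (\<lambda>z. T (s i) z - T (s k) z) < e" if "i \<ge> N" "k \<ge> N" for i k
    proof -
      have le: "2 / real (Suc j) \<le> 2 * inverse (real (Suc N))" if "j \<ge> N" for j
        unfolding divide_inverse using that by (intro mult_left_mono le_imp_inverse_le) auto
      have "norm_sq H (\<lambda>z. T (s i) z - T (s k) z) = norm_sq H (\<lambda>z. s i z - s k z)"
        using S_norm[OF S_diff[OF s(1) s(1)]] by (simp only: T_diff)
      also have "\<dots> \<le> 2 / real (Suc i) + 2 / real (Suc k)" by (rule cauchy)
      also have "\<dots> \<le> 2 * inverse (real (Suc N)) + 2 * inverse (real (Suc N))"
        by (intro add_mono le that)
      also have "\<dots> < e" using N by simp
      finally show ?thesis .
    qed
    then show ?thesis by blast
  qed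
  \<comment> \<open>Completeness is applied to the images \<open>T (s n)\<close>: their limit lies
    in the carrier and only has to be recognised as \<open>T f\<close>.\<close>
  obtain F where F: "F \<in> carrier H" "(\<lambda>n. norm_sq H (\<lambda>z. T (s n) z - F z)) \<longlonglongrightarrow> 0"
    by (rule complete[of "\<lambda>n. T (s n)", OF S_T[OF s(1)] C])
  have sq0: "X \<longlonglongrightarrow> L" if "\<And>n. (cmod (X n - L))\<^sup>2 \<le> b n" "b \<longlonglongrightarrow> 0" for X b and L :: complex
  proof -
    have "(\<lambda>n. (cmod (X n - L))\<^sup>2) \<longlonglongrightarrow> 0"
      by (rule tendsto_sandwich[OF always_eventually always_eventually tendsto_const that(2)])
        (simp_all only: that(1) zero_le_power2 simp_thms)
    then have "(\<lambda>n. sqrt ((cmod (X n - L))\<^sup>2)) \<longlonglongrightarrow> sqrt 0" by (rule tendsto_real_sqrt)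
    then have "(\<lambda>n. cmod (X n - L)) \<longlonglongrightarrow> 0"
      by (simp only: real_sqrt_abs abs_norm_cancel real_sqrt_zero)
    then show ?thesis by (simp only: tendsto_norm_zero_iff LIM_zero_iff)
  qed
  have lim1: "(\<lambda>n. T (s n) w) \<longlonglongrightarrow> F w" if w: "w \<in> disc" for w
  proof (rule sq0)
    show "(cmod (T (s n) w - F w))\<^sup>2 \<le> norm_sq H (\<lambda>z. T (s n) z - F z) * norm_sq H (kf w)" for n
      using point_evaluation_norm[OF diff_in[OF S_T[OF s(1)] F(1)] w] .
    show "(\<lambda>n. norm_sq H (\<lambda>z. T (s n) z - F z) * norm_sq H (kf w)) \<longlonglongrightarrow> 0"
      using tendsto_mult_right[OF F(2), of "norm_sq H (kf w)"] by simp
  qed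
  \<comment> \<open>\<open>s n\<close> is within \<open>1 / (n + 1)\<close> of the minimal squared
    distance, and adding multiples of \<open>kf w\<close> stays in \<open>S\<close>, so
    \<open>point_evaluation_bound\<close> makes \<open>f - s n\<close> small at each point.
    Convergence to \<open>f\<close> is claimed only pointwise.\<close>
  have lim2: "(\<lambda>n. s n w) \<longlonglongrightarrow> f w" if w: "w \<in> disc" for w
  proof (rule sq0)
    fix n
    have "(cmod (f w - s n w))\<^sup>2 \<le> (1 / real (Suc n)) * norm_sq H (kf w)"
    proof (rule point_evaluation_bound[OF diff_in[OF f S_H[OF s(1)]] w])
      fix t
      have "d \<le> D (\<lambda>z. s n z + t * kf w z)"
        by (intro dle S_add S_scale S_kf s w)
      then show "norm_sq H (\<lambda>z. f z - s n z) - 1 / real (Suc n) \<le> norm_sq H (\<lambda>z. f z - s n z - t * kf w z)"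
        using s(2)[of n] by (simp add: D_def diff_diff_eq)
    qed
    then show "(cmod (s n w - f w))\<^sup>2 \<le> (1 / real (Suc n)) * norm_sq H (kf w)"
      by (simp add: norm_minus_commute)
    have "(\<lambda>n. 1 / real (Suc n) * norm_sq H (kf w)) \<longlonglongrightarrow> 0 * norm_sq H (kf w)"
      by (intro tendsto_mult tendsto_const) (use LIMSEQ_inverse_real_of_nat in \<open>simp add: inverse_eq_divide\<close>)
    then show "(\<lambda>n. 1 / real (Suc n) * norm_sq H (kf w)) \<longlonglongrightarrow> 0" by simp
  qed
  have "T f = F"
  proof
    fix z show "T f z = F z"
    proof (cases "z \<in> disc")
      case True
      have "(\<lambda>n. m z * s n (\<phi> z)) \<longlonglongrightarrow> m z * f (\<phi> z)"
        by (intro tendsto_mult tendsto_const lim2 \<phi>(1) True)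
      moreover have "(\<lambda>n. m z * s n (\<phi> z)) \<longlonglongrightarrow> F z"
        using lim1[OF True] True unfolding T_def by simp
      ultimately have "m z * f (\<phi> z) = F z" by (rule LIMSEQ_unique)
      then show ?thesis using True unfolding T_def by simp
    next
      case False
      then show ?thesis using zero_outside[OF F(1)] by (simp add: T_def)
    qed
  qed
  then show ?thesis using F(1) unfolding T_def by simp
qed

end

subsection \<open>Invariance of the spaces and the multiplier\<close>

lemma Re_one_minus_pos:
  assumes "cmod z < 1" "cmod w < 1"
  shows "0 < Re (1 - z * cnj w)"
proof -
  have "cmod (z * cnj w) < 1 * 1"
    unfolding norm_mult complex_mod_cnj using assms by (intro mult_strict_mono') auto
  then show ?thesis using complex_Re_le_cmod[of "z * cnj w"] by simp
qed

context moebius_cover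
begin

text \<open>The logarithm of \<open>mob_kernel_identity\<close>, doubled to match the term
  \<open>2 * Ln\<close> in \<open>logd\<close>. Being purely imaginary, \<open>theta g\<close>
  cancels between \<open>logd g z\<close> and \<open>cnj (logd g w)\<close>.\<close>

lemma Ln_kernel:
  assumes g: "g \<in> G" and z: "z \<in> disc" and w: "w \<in> disc"
  shows "2 * Ln (1 - act g z * cnj (act g w)) = 2 * Ln (1 - z * cnj w) + logd g z + cnj (logd g w)"
proof -
  define r where "r = 1 - (cmod (bc g))\<^sup>2"
  have r: "0 < r" using cmod_bc_sq_less_1[OF g] by (simp add: r_def)
  define x where "x = 1 + cnj (bc g) * uc g * z"
  define y where "y = 1 + cnj (bc g) * uc g * w"
  define s where "s = 1 - z * cnj w"
  define t where "t = 1 - act g z * cnj (act g w)"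
  have x: "0 < Re x" and y: "0 < Re y" using denominator_pos g z w by (auto simp: x_def y_def)
  have s: "0 < Re s" using Re_one_minus_pos z w by (simp add: s_def)
  have t: "0 < Re t" using Re_one_minus_pos[of "act g z" "act g w"] act_disc[OF g] z w by (simp add: t_def)
  have nz: "x \<noteq> 0" "y \<noteq> 0" "s \<noteq> 0" "t \<noteq> 0" using x y s t by force+
  have im: "\<bar>Im (Ln x)\<bar> < pi/2" "\<bar>Im (Ln y)\<bar> < pi/2" "\<bar>Im (Ln s)\<bar> < pi/2" "\<bar>Im (Ln t)\<bar> < pi/2"
    using Re_Ln_pos_lt nz x y s t by blast+
  have T: "t = of_real r * s / (x * cnj y)"
    using mob_kernel_identity[OF norm_uc[OF g] bc_less_1[OF g], of z w] z w
    unfolding t_def s_def x_def y_def r_def act_eq_mob[OF g z] act_eq_mob[OF g w] by simp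
  have e1: "exp (complex_of_real (ln r)) = of_real r" using r by (simp only: exp_of_real exp_ln)
  have e2: "exp (cnj (Ln y)) = cnj y" using nz by (simp add: exp_cnj[symmetric])
  have "exp (of_real (ln r) + Ln s - Ln x - cnj (Ln y)) = of_real r * s / x / cnj y"
    by (simp only: exp_add exp_diff e1 e2 exp_Ln[OF nz(1)] exp_Ln[OF nz(3)])
  also have "\<dots> = t" unfolding T by simp
  also have "\<dots> = exp (Ln t)" by (rule exp_Ln[OF nz(4), symmetric])
  finally have e: "exp (Ln t) = exp (of_real (ln r) + Ln s - Ln x - cnj (Ln y))" by (rule sym)
  \<comment> \<open>Four logarithms of numbers in the right half-plane enter, each with imaginary
    part below \<open>pi / 2\<close> in modulus; this excludes a jump by 2 pi i.\<close>
  have "\<bar>Im (Ln t) - Im (of_real (ln r) + Ln s - Ln x - cnj (Ln y))\<bar> < 2 * pi"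
    using im by simp
  then have lt: "Ln t = of_real (ln r) + Ln s - Ln x - cnj (Ln y)"
    by (rule exp_complex_eqI) (rule e)
  have th: "cnj (theta g) = - theta g" using Re_theta[OF g] by (simp add: complex_eq_iff)
  have lz: "logd g z = theta g + of_real (ln r) - 2 * Ln x"
    by (simp add: logd_def r_def x_def)
  have lw: "cnj (logd g w) = - theta g + of_real (ln r) - 2 * cnj (Ln y)"
    by (simp add: logd_def r_def y_def th)
  show ?thesis unfolding t_def[symmetric] s_def[symmetric] lt lz lw by (simp add: algebra_simps)
qed

text \<open>Multiplying \<open>Ln_kernel\<close> by \<open>- \<alpha>\<close> settles all branches
  at once. The result is the hypothesis on \<open>K\<close> in
  \<open>weighted_composition_in\<close>.\<close>

lemma kernel_transform:
  assumes g: "g \<in> G" and z: "z \<in> disc" and w: "w \<in> disc"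
  shows "(1 - z * cnj w) powr of_real (- 2 * \<alpha>) = exp (of_real \<alpha> * logd g z) *
    (1 - act g z * cnj (act g w)) powr of_real (- 2 * \<alpha>) * cnj (exp (of_real \<alpha> * logd g w))"
proof -
  have nz: "1 - z * cnj w \<noteq> 0" "1 - act g z * cnj (act g w) \<noteq> 0"
    using Re_one_minus_pos[of z w] Re_one_minus_pos[of "act g z" "act g w"] act_disc[OF g] z w
    by force+
  have "of_real (- 2 * \<alpha>) * Ln (1 - act g z * cnj (act g w)) =
      - of_real \<alpha> * (2 * Ln (1 - act g z * cnj (act g w)))" by simp
  also have "\<dots> = of_real (- 2 * \<alpha>) * Ln (1 - z * cnj w) - of_real \<alpha> * logd g z - of_real \<alpha> * cnj (logd g w)"
    unfolding Ln_kernel[OF assms] by (simp add: algebra_simps)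
  finally have e: "of_real (- 2 * \<alpha>) * Ln (1 - z * cnj w) = of_real \<alpha> * logd g z +
      of_real (- 2 * \<alpha>) * Ln (1 - act g z * cnj (act g w)) + of_real \<alpha> * cnj (logd g w)"
    by simp
  have "cnj (exp (of_real \<alpha> * logd g w)) = exp (of_real \<alpha> * cnj (logd g w))"
    by (simp add: exp_cnj)
  then show ?thesis using nz unfolding powr_def by (simp only: e exp_add if_False)
qed

lemma D_plus_in:
  assumes g: "g \<in> G" and A: "is_A \<alpha> H" and f: "f \<in> carrier H"
  shows "D_plus Gt act \<alpha> g f \<in> carrier H"
proof -
  let ?K = "\<lambda>z w. (1 - z * cnj w) powr of_real (- 2 * \<alpha>)"
  interpret kernel_space H ?K using A by unfold_locales (auto simp: is_A_def)
  let ?h = "inv\<^bsub>Gt\<^esub> g"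
  have h: "?h \<in> G" using g by simp
  have surj: "\<exists>v\<in>disc. act ?h v = w" if w: "w \<in> disc" for w
    using act_mult[OF h g w] act_one[OF w] act_disc[OF g w] l_inv[OF g]
    by (intro bexI[of _ "act g w"]) auto
  have "(\<lambda>z. if z \<in> disc then exp (of_real \<alpha> * logd ?h z) * f (act ?h z) else 0) \<in> carrier H"
    by (rule weighted_composition_in[OF _ surj _ _ f]) (use act_disc[OF h] kernel_transform[OF h] in auto)
  moreover have "D_plus Gt act \<alpha> g f = (\<lambda>z. if z \<in> disc then exp (of_real \<alpha> * logd ?h z) * f (act ?h z) else 0)"
    unfolding D_plus_def by (intro ext if_cong refl) (simp only: dpow_eq[OF h])
  ultimately show ?thesis by simp
qed

section \<open>Higher derivatives of weighted compositions\<close>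

lemma exp_half_power:
  "exp (of_real (x + real n / 2) * L) = exp (of_real x * L) * exp (L / 2) ^ n" for L :: complex
proof -
  have "of_real (x + real n / 2) * L = of_real x * L + of_nat n * (L / 2)" by (simp add: algebra_simps)
  then show ?thesis by (simp only: exp_add exp_of_nat_mult)
qed

text \<open>Collects the terms of the \<open>k\<close>-th derivative of
  \<open>(g')^\<alpha> (f \<circ> g)\<close> in which \<open>f\<close> has been differentiated
  \<open>i\<close> times. Differentiating \<open>(g')^(\<alpha> + n/2)\<close> yields the factor
  \<open>- cc g * (2 * \<alpha> + n)\<close> and raises the exponent by 1/2; differentiating
  \<open>f \<circ> g\<close> raises it by 1.\<close>

definition coef :: "real \<Rightarrow> 'g \<Rightarrow> nat \<Rightarrow> nat \<Rightarrow> complex" where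
  "coef \<alpha> g k i = of_nat (k choose i) * of_real (pochhammer (2 * \<alpha> + real i) (k - i)) * (- cc g) ^ (k - i)"

text \<open>The last derivative falls either on the power of \<open>g'\<close> (first summand) or on
  \<open>f \<circ> g\<close> (second summand).\<close>

lemma coef_Suc:
  assumes "i \<le> Suc k"
  shows "coef \<alpha> g (Suc k) i = coef \<alpha> g k i * (- cc g * of_real (2 * \<alpha> + real (k + i))) +
    (case i of 0 \<Rightarrow> 0 | Suc j \<Rightarrow> coef \<alpha> g k j)"
proof (cases i)
  case 0
  then show ?thesis by (simp add: coef_def pochhammer_Suc algebra_simps)
next
  case (Suc j)
  show ?thesis
  proof (cases "i = Suc k")
    case True
    then show ?thesis using Suc by (simp add: coef_def)
  next
    case False
    define n where "n = k - i"
    have n: "k - j = Suc n" "Suc k - i = Suc n" "k = n + Suc j"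
      using False assms Suc by (auto simp: n_def)
    define p where "p = complex_of_real (pochhammer (2 * \<alpha> + real i) n)"
    define d where "d = - cc g"
    \<comment> \<open>Without the common factor \<open>p * (d * d ^ n)\<close>, and with
      \<open>C i = k choose i\<close>, the claim reads \<open>(C i + C j) * (2 * \<alpha> + k) = C i
      * (2 * \<alpha> + k + i) + C j * (2 * \<alpha> + j)\<close>, that is
      \<open>(k - j) * C j = i * C i\<close>.\<close>
    have "Suc j * (k choose Suc j) = (k - j) * (k choose j)"
      by (simp only: binomial_absorption binomial_absorb_comp)
    then have b: "complex_of_nat (Suc j) * of_nat (k choose Suc j) = of_nat (Suc n) * of_nat (k choose j)"
      unfolding n(1) by (metis of_nat_mult)
    have 1: "coef \<alpha> g k i = of_nat (k choose Suc j) * p * d ^ n"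
      by (simp add: coef_def n_def p_def d_def Suc)
    have "pochhammer (2 * \<alpha> + real j) (Suc n) = (2 * \<alpha> + real j) * pochhammer (2 * \<alpha> + real i) n"
    proof -
      have "2 * \<alpha> + real j + 1 = 2 * \<alpha> + real i" by (simp add: Suc)
      then show ?thesis by (simp only: pochhammer_rec)
    qed
    then have 2: "coef \<alpha> g k j = of_nat (k choose j) * (of_real (2 * \<alpha> + real j) * p) * (d * d ^ n)"
      unfolding coef_def n(1) p_def d_def power_Suc by (simp only: of_real_mult)
    have "pochhammer (2 * \<alpha> + real i) (Suc n) = pochhammer (2 * \<alpha> + real i) n * (2 * \<alpha> + real k)"
      unfolding pochhammer_Suc Suc n(3) by (simp add: algebra_simps)
    then have 3: "coef \<alpha> g (Suc k) i =
        (of_nat (k choose Suc j) + of_nat (k choose j)) * (p * of_real (2 * \<alpha> + real k)) * (d * d ^ n)"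
      unfolding coef_def n(2) p_def d_def power_Suc of_real_mult[symmetric]
      by (simp add: Suc add.commute)
    have kk: "complex_of_nat k = of_nat (Suc n) + of_nat j" "complex_of_nat i = of_nat (Suc j)"
      using n(3) Suc by simp_all
    have "(of_nat (k choose Suc j) + of_nat (k choose j)) * (2 * of_real \<alpha> + complex_of_nat k) =
       of_nat (k choose Suc j) * (2 * of_real \<alpha> + (of_nat k + of_nat i)) + of_nat (k choose j) * (2 * of_real \<alpha> + of_nat j)"
      using b unfolding kk by (simp only: algebra_simps)
    then have "(of_nat (k choose Suc j) + of_nat (k choose j)) * (2 * of_real \<alpha> + complex_of_nat k) * (p * (d * d ^ n)) =
       (of_nat (k choose Suc j) * (2 * of_real \<alpha> + (of_nat k + of_nat i)) + of_nat (k choose j) * (2 * of_real \<alpha> + of_nat j)) * (p * (d * d ^ n))"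
      by (simp only:)
    then show ?thesis unfolding 3 1 unfolding Suc nat.case 2 d_def[symmetric]
      by (simp add: Suc algebra_simps)
  qed
qed

lemma higher_deriv_weighted_composition:
  assumes g: "g \<in> G" and f: "f holomorphic_on disc"
    and F: "\<And>z. z \<in> disc \<Longrightarrow> F z = exp (of_real \<alpha> * logd g z) * f (act g z)"
    and z: "z \<in> disc"
  shows "(deriv ^^ k) F z = (\<Sum>i\<le>k. coef \<alpha> g k i *
     (exp (of_real (\<alpha> + real (k + i) / 2) * logd g z) * (deriv ^^ i) f (act g z)))"
  using z
proof (induction k arbitrary: z)
  case 0
  then show ?case by (simp add: F coef_def)
next
  case (Suc k)
  define W where "W n z = exp (of_real (\<alpha> + real n / 2) * logd g z)" for n z
  define d where "d = - cc g"
  have W_deriv: "(W n has_field_derivative d * of_real (2 * \<alpha> + real n) * W (Suc n) z) (at z)" for n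
  proof -
    have "((\<lambda>z. exp (of_real (\<alpha> + real n / 2) * logd g z)) has_field_derivative
        exp (of_real (\<alpha> + real n / 2) * logd g z) * (of_real (\<alpha> + real n / 2) * (- 2 * cc g * exp (logd g z / 2)))) (at z)"
      by (intro DERIV_chain2[OF DERIV_exp] DERIV_cmult logd_deriv g Suc.prems)
    moreover have "W (Suc n) z = W n z * exp (logd g z / 2)"
      unfolding W_def exp_half_power by simp
    ultimately show ?thesis unfolding W_def[abs_def] d_def
      by (simp add: algebra_simps)
  qed
  have W2: "W n z * exp (logd g z) = W (Suc (Suc n)) z" for n
  proof -
    have "exp (logd g z) = exp (logd g z / 2) * exp (logd g z / 2)" by (simp add: exp_add[symmetric])
    then show ?thesis unfolding W_def exp_half_power by simp
  qed
  have f_deriv: "((\<lambda>z. (deriv ^^ i) f (act g z)) has_field_derivative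
      (deriv ^^ Suc i) f (act g z) * exp (logd g z)) (at z)" for i
  proof -
    have "(deriv ^^ i) f holomorphic_on disc" by (intro holomorphic_higher_deriv f) auto
    from holomorphic_derivI[OF this open_ball act_disc[OF g Suc.prems]]
    have "((deriv ^^ i) f has_field_derivative (deriv ^^ Suc i) f (act g z)) (at (act g z))" by simp
    from DERIV_chain2[OF this act_deriv[OF g Suc.prems]] show ?thesis .
  qed
  \<comment> \<open>Both contributions of the \<open>i\<close>-th term land on this scale: the power
    gives \<open>X i\<close>, and differentiating \<open>f\<close> gives \<open>X (Suc i)\<close>,
    since the chain rule factor \<open>g'\<close> advances \<open>W\<close> by two steps.\<close>
  define X where "X i = W (Suc k + i) z * (deriv ^^ i) f (act g z)" for i
  have "((\<lambda>z. \<Sum>i\<le>k. coef \<alpha> g k i * (W (k + i) z * (deriv ^^ i) f (act g z))) has_field_derivative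
      (\<Sum>i\<le>k. coef \<alpha> g k i * (d * of_real (2 * \<alpha> + real (k + i)) * W (Suc (k + i)) z * (deriv ^^ i) f (act g z) +
         (deriv ^^ Suc i) f (act g z) * exp (logd g z) * W (k + i) z))) (at z)"
    by (intro DERIV_sum DERIV_cmult DERIV_mult W_deriv f_deriv)
  then have "((deriv ^^ k) F has_field_derivative
      (\<Sum>i\<le>k. coef \<alpha> g k i * (d * of_real (2 * \<alpha> + real (k + i)) * W (Suc (k + i)) z * (deriv ^^ i) f (act g z) +
         (deriv ^^ Suc i) f (act g z) * exp (logd g z) * W (k + i) z))) (at z)"
    by (rule has_field_derivative_transform_within_open[of _ _ _ disc])
      (use Suc.prems Suc.IH in \<open>auto simp: W_def\<close>)
  then have "(deriv ^^ Suc k) F z =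
      (\<Sum>i\<le>k. coef \<alpha> g k i * (d * of_real (2 * \<alpha> + real (k + i)) * W (Suc (k + i)) z * (deriv ^^ i) f (act g z) +
         (deriv ^^ Suc i) f (act g z) * exp (logd g z) * W (k + i) z))"
    by (simp add: DERIV_imp_deriv)
  also have "\<dots> = (\<Sum>i\<le>k. coef \<alpha> g k i * (d * of_real (2 * \<alpha> + real (k + i))) * X i + coef \<alpha> g k i * X (Suc i))"
  proof (rule sum.cong[OF refl])
    fix i assume "i \<in> {..k}"
    have "(deriv ^^ Suc i) f (act g z) * exp (logd g z) * W (k + i) z = X (Suc i)"
      unfolding X_def using W2[of "k + i"] by (simp add: mult_ac)
    moreover have "W (Suc (k + i)) z * (deriv ^^ i) f (act g z) = X i" unfolding X_def by simp
    ultimately show "coef \<alpha> g k i * (d * of_real (2 * \<alpha> + real (k + i)) * W (Suc (k + i)) z * (deriv ^^ i) f (act g z) +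
         (deriv ^^ Suc i) f (act g z) * exp (logd g z) * W (k + i) z) =
        coef \<alpha> g k i * (d * of_real (2 * \<alpha> + real (k + i))) * X i + coef \<alpha> g k i * X (Suc i)"
      by (simp only: distrib_left mult.assoc)
  qed
  also have "\<dots> = (\<Sum>i\<le>k. coef \<alpha> g k i * (d * of_real (2 * \<alpha> + real (k + i))) * X i) + (\<Sum>i\<le>k. coef \<alpha> g k i * X (Suc i))"
    by (rule sum.distrib)
  \<comment> \<open>The added term vanishes because \<open>k choose Suc k = 0\<close>.\<close>
  also have "(\<Sum>i\<le>k. coef \<alpha> g k i * (d * of_real (2 * \<alpha> + real (k + i))) * X i) =
      (\<Sum>i\<le>Suc k. coef \<alpha> g k i * (d * of_real (2 * \<alpha> + real (k + i))) * X i)"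
    by (simp add: coef_def)
  also have "(\<Sum>i\<le>k. coef \<alpha> g k i * X (Suc i)) = (\<Sum>i\<le>Suc k. (case i of 0 \<Rightarrow> 0 | Suc j \<Rightarrow> coef \<alpha> g k j) * X i)"
    unfolding sum.atMost_Suc_shift by simp
  also have "(\<Sum>i\<le>Suc k. coef \<alpha> g k i * (d * of_real (2 * \<alpha> + real (k + i))) * X i) +
      (\<Sum>i\<le>Suc k. (case i of 0 \<Rightarrow> 0 | Suc j \<Rightarrow> coef \<alpha> g k j) * X i) =
      (\<Sum>i\<le>Suc k. coef \<alpha> g (Suc k) i * X i)"
    unfolding sum.distrib[symmetric] distrib_right[symmetric] d_def
    by (rule sum.cong[OF refl]) (simp only: coef_Suc atMost_iff)
  finally have "(deriv ^^ Suc k) F z = (\<Sum>i\<le>Suc k. coef \<alpha> g (Suc k) i * X i)" .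
  then show ?case by (simp only: X_def W_def)
qed

section \<open>The multiplier identity\<close>

lemma J_mat_index:
  assumes "g \<in> G" "z \<in> disc" "p < m + 1" "l < m + 1"
  shows "J_mat Gt act m lam g z $$ (p, l) = (if l \<le> p then of_nat (p choose l) * (- cc g) ^ (p - l) *
     (exp (of_real (lam - real m / 2) * logd g z) * exp (logd g z / 2) ^ (p + l)) else 0)"
  using assms by (simp only: J_mat_def index_mat prod.case c_const_eq dpow_eq exp_half_power)

text \<open>Only \<open>l \<le> k \<le> p\<close> contribute. Raising \<open>k\<close> by one brings
  a factor \<open>Q\<close> from the matrix of \<open>h\<close> and a factor \<open>R\<close> from
  that of \<open>g\<close>, and trades \<open>- cc h\<close> for \<open>- cc g\<close>; so by
  \<open>choose_mult\<close> the sum is the binomial expansion of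
  \<open>(- cc g * R * Q - cc h) ^ (p - l)\<close>.\<close>

lemma J_mat_mult:
  assumes g: "g \<in> G" and h: "h \<in> G" and z: "z \<in> disc"
  shows "J_mat Gt act m lam (g \<otimes>\<^bsub>Gt\<^esub> h) z = J_mat Gt act m lam h z * J_mat Gt act m lam g (act h z)"
    (is "?L = ?A * ?B")
proof (rule eq_matI)
  have hz: "act h z \<in> disc" by (rule act_disc[OF h z])
  have gh: "g \<otimes>\<^bsub>Gt\<^esub> h \<in> G" using g h by simp
  have dims: "?L \<in> carrier_mat (m+1) (m+1)" "?A \<in> carrier_mat (m+1) (m+1)" "?B \<in> carrier_mat (m+1) (m+1)"
    by (simp_all add: J_mat_def)
  show "dim_row ?L = dim_row (?A * ?B)" "dim_col ?L = dim_col (?A * ?B)" using dims by auto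
  fix p l assume "p < dim_row (?A * ?B)" "l < dim_col (?A * ?B)"
  then have p: "p < m + 1" and l: "l < m + 1" using dims by auto
  define a where "a = lam - real m / 2"
  define Q where "Q = exp (logd h z / 2)"
  define R where "R = exp (logd g (act h z) / 2)"
  define Eh where "Eh = exp (of_real a * logd h z)"
  define Eg where "Eg = exp (of_real a * logd g (act h z))"
  have A: "?A $$ (p, k) = (if k \<le> p then of_nat (p choose k) * (- cc h) ^ (p - k) * (Eh * Q ^ (p + k)) else 0)"
    if "k < m + 1" for k
    using J_mat_index[OF h z p that] unfolding a_def Q_def Eh_def .
  have B: "?B $$ (k, l) = (if l \<le> k then of_nat (k choose l) * (- cc g) ^ (k - l) * (Eg * R ^ (k + l)) else 0)"
    if "k < m + 1" for k
    using J_mat_index[OF g hz that l] unfolding a_def R_def Eg_def .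
  have "(?A * ?B) $$ (p, l) = (\<Sum>k<m+1. ?A $$ (p, k) * ?B $$ (k, l))"
    using dims p l by (simp add: scalar_prod_def atLeast0LessThan)
  also have "\<dots> = ?L $$ (p, l)"
  proof (cases "l \<le> p")
    case False
    have "?A $$ (p, k) * ?B $$ (k, l) = 0" if "k < m + 1" for k
      using A[OF that] B[OF that] False by auto
    then have "(\<Sum>k<m+1. ?A $$ (p, k) * ?B $$ (k, l)) = 0" by (intro sum.neutral ballI) (simp only: lessThan_iff)
    then show ?thesis using J_mat_index[OF gh z p l] False by (simp only: if_False)
  next
    case True
    define n where "n = p - l"
    have pn: "p = l + n" using True by (simp add: n_def)
    have "(\<Sum>k<m+1. ?A $$ (p, k) * ?B $$ (k, l)) = (\<Sum>k\<in>{l..p}. ?A $$ (p, k) * ?B $$ (k, l))"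
      by (rule sum.mono_neutral_right) (use p A B in auto)
    also have "\<dots> = (\<Sum>i\<le>n. ?A $$ (p, l + i) * ?B $$ (l + i, l))"
      by (rule sum.reindex_bij_witness[of _ "\<lambda>i. l + i" "\<lambda>k. k - l"]) (auto simp: pn)
    also have "\<dots> = (\<Sum>i\<le>n. of_nat (p choose l) * (Eh * Eg * Q ^ (p + l) * R ^ (2 * l)) *
        (of_nat (n choose i) * (- cc g * R * Q) ^ i * (- cc h) ^ (n - i)))"
    proof (rule sum.cong[OF refl])
      fix i assume "i \<in> {..n}"
      then have i: "i \<le> n" by simp
      then have im: "l + i < m + 1" "l + i \<le> p" "p - (l + i) = n - i" "l + i + l = 2 * l + i"
          "p + (l + i) = p + l + i" using p pn by auto
      have "(p choose (l + i)) * ((l + i) choose l) = (p choose l) * (n choose i)"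
        using choose_mult[of l "l + i" p] im(2) by (simp add: n_def)
      then have c: "complex_of_nat (p choose (l + i)) * of_nat ((l + i) choose l) = of_nat (p choose l) * of_nat (n choose i)"
        by (metis of_nat_mult)
      have "?A $$ (p, l + i) * ?B $$ (l + i, l) =
          (of_nat (p choose (l + i)) * of_nat ((l + i) choose l)) *
          ((- cc h) ^ (n - i) * (Eh * Q ^ (p + l + i)) * ((- cc g) ^ i * (Eg * R ^ (2 * l + i))))"
        using A[OF im(1)] B[OF im(1)] im(2) unfolding im(3,4,5) by (simp add: mult_ac)
      also have "\<dots> = of_nat (p choose l) * (Eh * Eg * Q ^ (p + l) * R ^ (2 * l)) *
        (of_nat (n choose i) * (- cc g * R * Q) ^ i * (- cc h) ^ (n - i))"
        unfolding c power_add power_mult_distrib by (simp only: mult_ac)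
      finally show "?A $$ (p, l + i) * ?B $$ (l + i, l) = of_nat (p choose l) * (Eh * Eg * Q ^ (p + l) * R ^ (2 * l)) *
        (of_nat (n choose i) * (- cc g * R * Q) ^ i * (- cc h) ^ (n - i))" .
    qed
    also have "\<dots> = of_nat (p choose l) * (Eh * Eg * Q ^ (p + l) * R ^ (2 * l)) * (- cc g * R * Q + - cc h) ^ n"
      by (simp only: binomial_ring sum_distrib_left)
    \<comment> \<open>\<open>cc_mult\<close> collapses the base; the power \<open>R ^ n\<close> that
      it releases completes \<open>R ^ (2 * l)\<close> to \<open>R ^ (p + l)\<close>.\<close>
    also have "- cc g * R * Q + - cc h = - cc (g \<otimes>\<^bsub>Gt\<^esub> h) * R"
      using cc_mult[OF g h z] unfolding Q_def R_def by simp
    also have "of_nat (p choose l) * (Eh * Eg * Q ^ (p + l) * R ^ (2 * l)) * (- cc (g \<otimes>\<^bsub>Gt\<^esub> h) * R) ^ n =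
        of_nat (p choose l) * (- cc (g \<otimes>\<^bsub>Gt\<^esub> h)) ^ n * ((Eh * Eg) * (Q * R) ^ (p + l))"
    proof -
      have "p + l = 2 * l + n" using pn by simp
      then have "R ^ (p + l) = R ^ (2 * l) * R ^ n" by (simp only: power_add)
      then show ?thesis unfolding power_mult_distrib by (simp only: mult_ac)
    qed
    also have "\<dots> = ?L $$ (p, l)"
    proof -
      have "Eh * Eg = exp (of_real a * logd (g \<otimes>\<^bsub>Gt\<^esub> h) z)"
        unfolding Eh_def Eg_def logd_mult[OF g h z] by (simp only: distrib_left exp_add)
      moreover have "Q * R = exp (logd (g \<otimes>\<^bsub>Gt\<^esub> h) z / 2)"
        unfolding Q_def R_def logd_mult[OF g h z] by (simp only: add_divide_distrib exp_add)
      ultimately show ?thesis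
        using J_mat_index[OF gh z p l] True unfolding a_def n_def by (simp only: if_True)
    qed
    finally show ?thesis .
  qed
  finally show "?L $$ (p, l) = (?A * ?B) $$ (p, l)" by simp
qed

lemma multiplier_J_mat: "multiplier Gt act (m + 1) (J_mat Gt act m lam)"
  unfolding multiplier_def
proof (intro conjI allI impI ballI)
  show "J_mat Gt act m lam g z \<in> carrier_mat (m + 1) (m + 1)" for g z
    by (simp add: J_mat_def)
  show "J_mat Gt act m lam (g \<otimes>\<^bsub>Gt\<^esub> h) z = J_mat Gt act m lam h z * J_mat Gt act m lam g (act h z)"
    if "g \<in> G" "h \<in> G" "z \<in> disc" for g h z
    by (rule J_mat_mult[OF that])
  fix p l assume pl: "p < m + 1" "l < m + 1"
  let ?a = "lam - real m / 2"
  let ?J = "\<lambda>g z. if l \<le> p then of_nat (p choose l) * (- cc g) ^ (p - l) *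
     (exp (of_real ?a * logd g z) * exp (logd g z / 2) ^ (p + l)) else 0"
  have c: "continuous_on (G \<times> disc) (\<lambda>x. cc (fst x))"
    by (rule continuous_on_compose2[OF continuous_on_cc]) (auto intro: continuous_intros)
  have L: "continuous_on (G \<times> disc) (\<lambda>x. logd (fst x) (snd x))"
    by (rule continuous_on_logd_compose) (auto intro: continuous_intros)
  have "continuous_on (G \<times> disc) (\<lambda>x. ?J (fst x) (snd x))"
    by (cases "l \<le> p") (simp_all only: if_True if_False, intro continuous_intros c L, simp_all)
  then show "continuous_on (G \<times> disc) (\<lambda>(g, z). J_mat Gt act m lam g z $$ (p, l))"
    by (rule continuous_on_eq) (use J_mat_index pl in auto)
  fix g assume g: "g \<in> G"
  have "?J g holomorphic_on disc"
    by (cases "l \<le> p") (simp_all only: if_True if_False, intro holomorphic_intros logd_holomorphic g, simp_all)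
  then show "(\<lambda>z. J_mat Gt act m lam g z $$ (p, l)) holomorphic_on disc"
    by (rule holomorphic_transform) (use J_mat_index[OF g _ pl] in auto)
qed

section \<open>The intertwining relation\<close>

text \<open>Both sides match term by term in the derivatives of \<open>f\<close>:
  \<open>choose_mult\<close> and the splitting of the Pochhammer symbol of
  \<open>2 * \<alpha>\<close> at \<open>i\<close> turn products of the constants in
  \<open>J_mat\<close> and \<open>Gamma_j\<close> into \<open>coef\<close>. This splitting explains
  the Pochhammer normalisation of \<open>Gamma_j\<close>.\<close>

lemma Gamma_j_D_plus:
  assumes g: "g \<in> G" and f: "f holomorphic_on disc" and lam: "2 * lam - real m > 0"
    and z: "z \<in> disc" and j: "j \<le> m" and l: "l < m + 1"
  shows "vec_index (Gamma_j m lam j (D_plus Gt act (lam_j m lam j) g f) z) l =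
    (\<Sum>k<m+1. J_mat Gt act m lam (inv\<^bsub>Gt\<^esub> g) z $$ (l, k) *
        vec_index (Gamma_j m lam j f (act (inv\<^bsub>Gt\<^esub> g) z)) k)"
proof -
  let ?h = "inv\<^bsub>Gt\<^esub> g"
  define h where "h = ?h"
  have h: "h \<in> G" using g by (simp add: h_def)
  have hz: "act h z \<in> disc" by (rule act_disc[OF h z])
  define \<alpha> where "\<alpha> = lam_j m lam j"
  have a0: "0 < \<alpha>" using lam by (simp add: \<alpha>_def lam_j_def)
  define E where "E n = exp (of_real (\<alpha> + real n / 2) * logd h z)" for n
  define \<Gamma> where "\<Gamma> k = vec_index (Gamma_j m lam j f (act h z)) k" for k
  have Gam: "\<Gamma> k = (if j \<le> k then of_nat (k choose j) / of_real (pochhammer (2 * \<alpha>) (k - j)) *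
      (deriv ^^ (k - j)) f (act h z) else 0)" if "k < m + 1" for k
    using that hz by (simp add: \<Gamma>_def Gamma_j_def \<alpha>_def)
  let ?J = "J_mat Gt act m lam h z"
  have lhs: "vec_index (Gamma_j m lam j (D_plus Gt act \<alpha> g f) z) l =
     (if j \<le> l then of_nat (l choose j) / of_real (pochhammer (2 * \<alpha>) (l - j)) *
      (deriv ^^ (l - j)) (D_plus Gt act \<alpha> g f) z else 0)"
    using l z by (simp add: Gamma_j_def \<alpha>_def)
  have "(\<Sum>k<m+1. ?J $$ (l, k) * \<Gamma> k) = vec_index (Gamma_j m lam j (D_plus Gt act \<alpha> g f) z) l"
  proof (cases "j \<le> l")
    case False
    have "?J $$ (l, k) * \<Gamma> k = 0" if "k < m + 1" for k
      using Gam[OF that] J_mat_index[OF h z l that] False by auto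
    then have "(\<Sum>k<m+1. ?J $$ (l, k) * \<Gamma> k) = 0" by (intro sum.neutral ballI) (simp only: lessThan_iff)
    then show ?thesis using lhs False by (simp only: if_False)
  next
    case True
    define n where "n = l - j"
    have ln: "l = j + n" using True by (simp add: n_def)
    have D: "(deriv ^^ n) (D_plus Gt act \<alpha> g f) z = (\<Sum>i\<le>n. coef \<alpha> h n i * (E (n + i) * (deriv ^^ i) f (act h z)))"
      unfolding E_def
      by (rule higher_deriv_weighted_composition[OF h f _ z])
        (use h in \<open>simp add: D_plus_def h_def[symmetric] dpow_eq\<close>)
    have "(\<Sum>k<m+1. ?J $$ (l, k) * \<Gamma> k) = (\<Sum>k\<in>{j..l}. ?J $$ (l, k) * \<Gamma> k)"
    proof (rule sum.mono_neutral_right)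
      show "\<forall>k\<in>{..<m+1} - {j..l}. ?J $$ (l, k) * \<Gamma> k = 0"
        using Gam J_mat_index[OF h z l] by auto
    qed (use l in auto)
    also have "\<dots> = (\<Sum>i\<le>n. ?J $$ (l, j + i) * \<Gamma> (j + i))"
      by (rule sum.reindex_bij_witness[of _ "\<lambda>i. j + i" "\<lambda>k. k - j"]) (auto simp: ln)
    also have "\<dots> = (\<Sum>i\<le>n. of_nat (l choose j) / of_real (pochhammer (2 * \<alpha>) n) *
        (coef \<alpha> h n i * (E (n + i) * (deriv ^^ i) f (act h z))))"
    proof (rule sum.cong[OF refl])
      fix i assume "i \<in> {..n}"
      then have i: "i \<le> n" by simp
      then have im: "j + i < m + 1" "j + i \<le> l" "l - (j + i) = n - i" using l ln by auto
      have "(l choose (j + i)) * ((j + i) choose j) = (l choose j) * (n choose i)"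
        using choose_mult[of j "j + i" l] im(2) by (simp add: n_def)
      then have c: "complex_of_nat (l choose (j + i)) * of_nat ((j + i) choose j) = of_nat (l choose j) * of_nat (n choose i)"
        by (metis of_nat_mult)
      define d where "d = - cc h"
      define P where "P = complex_of_real (pochhammer (2 * \<alpha>) i)"
      define P' where "P' = complex_of_real (pochhammer (2 * \<alpha> + real i) (n - i))"
      have "pochhammer (2 * \<alpha>) n = pochhammer (2 * \<alpha>) i * pochhammer (2 * \<alpha> + real i) (n - i)"
        using pochhammer_product[OF i, of "2 * \<alpha>"] by simp
      then have PP: "complex_of_real (pochhammer (2 * \<alpha>) n) = P * P'" by (simp add: P_def P'_def)
      have P0: "P \<noteq> 0" "P' \<noteq> 0"
        using pochhammer_pos[of "2 * \<alpha>" i] pochhammer_pos[of "2 * \<alpha> + real i" "n - i"] a0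
        by (simp_all add: P_def P'_def)
      \<comment> \<open>With \<open>\<alpha> = lam - m / 2 + j\<close> and \<open>l = j + n\<close>
        the shift by \<open>j\<close> cancels from the exponent. This is why the same
        \<open>J_mat\<close> serves every \<open>j\<close>.\<close>
      have Ee: "exp (of_real (lam - real m / 2) * logd h z) * exp (logd h z / 2) ^ (l + (j + i)) = E (n + i)"
      proof -
        have "lam - real m / 2 + real (l + (j + i)) / 2 = \<alpha> + real (n + i) / 2"
          by (simp add: \<alpha>_def lam_j_def ln field_simps)
        then show ?thesis unfolding E_def exp_half_power[symmetric] by simp
      qed
      have "?J $$ (l, j + i) = of_nat (l choose (j + i)) * d ^ (n - i) * E (n + i)"
        using J_mat_index[OF h z l im(1)] im(2,3) Ee by (simp add: d_def)
      moreover have "\<Gamma> (j + i) = of_nat ((j + i) choose j) / P * (deriv ^^ i) f (act h z)"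
        using Gam[OF im(1)] by (simp add: P_def)
      ultimately have "?J $$ (l, j + i) * \<Gamma> (j + i) =
          (of_nat (l choose (j + i)) * of_nat ((j + i) choose j)) *
          (d ^ (n - i) * E (n + i) / P * (deriv ^^ i) f (act h z))" by simp
      also have "\<dots> = of_nat (l choose j) / (P * P') * (of_nat (n choose i) * P' * d ^ (n - i) *
          (E (n + i) * (deriv ^^ i) f (act h z)))"
        unfolding c using P0 by simp
      finally show "?J $$ (l, j + i) * \<Gamma> (j + i) = of_nat (l choose j) / of_real (pochhammer (2 * \<alpha>) n) *
        (coef \<alpha> h n i * (E (n + i) * (deriv ^^ i) f (act h z)))"
        unfolding PP coef_def P'_def d_def by (simp only: mult.assoc)
    qed
    also have "\<dots> = vec_index (Gamma_j m lam j (D_plus Gt act \<alpha> g f) z) l"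
      using lhs True unfolding n_def[symmetric] by (simp only: D sum_distrib_left if_True)
    finally show ?thesis .
  qed
  then show ?thesis unfolding \<Gamma>_def h_def \<alpha>_def by simp
qed

end

section \<open>Rescaling of the components and conclusion\<close>

lemma Gamma_j_scale:
  assumes "f holomorphic_on disc" "l < m + 1"
  shows "vec_index (Gamma_j m lam j (\<lambda>z. c * f z) z) l = c * vec_index (Gamma_j m lam j f z) l"
proof (cases "z \<in> disc")
  case True
  have "(deriv ^^ n) (\<lambda>z. c * f z) z = c * (deriv ^^ n) f z" for n
    using True by (intro higher_deriv_cmult[OF assms(1)]) auto
  then show ?thesis using assms(2) by (simp add: Gamma_j_def)
next
  case False
  then show ?thesis using assms(2) by (simp add: Gamma_j_def)
qed

lemma holomorphic_hilbert_space_scale: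
  "holomorphic_hilbert_space H \<Longrightarrow> f \<in> carrier H \<Longrightarrow> (\<lambda>z. c * f z) \<in> carrier H"
  unfolding holomorphic_hilbert_space_def by blast

lemma holomorphic_hilbert_space_holomorphic:
  "holomorphic_hilbert_space H \<Longrightarrow> f \<in> carrier H \<Longrightarrow> f holomorphic_on disc"
  unfolding holomorphic_hilbert_space_def by blast

lemma direct_sum_holomorphic:
  assumes "holomorphic_hilbert_space (A j)" "j \<le> m" "f \<in> direct_sum m A"
  shows "f j \<in> carrier (A j)" "f j holomorphic_on disc"
proof -
  show "f j \<in> carrier (A j)"
    using PiE_mem[of f "{..m}" "\<lambda>j. carrier (A j)" j] assms(2,3) unfolding direct_sum_def by simp
  then show "f j holomorphic_on disc" by (rule holomorphic_hilbert_space_holomorphic[OF assms(1)])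
qed

text \<open>Linearity of each \<open>Gamma_j\<close> moves the weight \<open>v j\<close> into the
  component. This bridges two descriptions of the space: its carrier is defined with weights 1,
  whereas \<open>U_rep\<close> uses the weights \<open>mu\<close>; \<open>v = 1 / mu\<close> and
  \<open>v = mu\<close> give the two directions.\<close>

lemma Gamma_sum_rescale:
  assumes A: "\<And>j. j \<le> m \<Longrightarrow> holomorphic_hilbert_space (A j)" and f: "f \<in> direct_sum m A"
    and u: "\<And>j. j \<le> m \<Longrightarrow> u j = w j * v j"
  shows "Gamma_sum m lam u f \<in> Gamma_sum m lam w ` direct_sum m A"
proof
  let ?f = "\<lambda>j\<in>{..m}. \<lambda>z. of_real (v j) * f j z"
  show "?f \<in> direct_sum m A"
    unfolding direct_sum_def
  proof (rule restrict_PiE_iff[THEN iffD2], intro ballI)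
    fix j assume "j \<in> {..m}"
    then have j: "j \<le> m" by simp
    show "(\<lambda>z. of_real (v j) * f j z) \<in> carrier (A j)"
      by (intro holomorphic_hilbert_space_scale A j direct_sum_holomorphic(1)[OF A[OF j] j f])
  qed
  show "Gamma_sum m lam u f = Gamma_sum m lam w ?f"
    unfolding Gamma_sum_def
  proof (intro ext vec_eq_iff[THEN iffD2] conjI allI impI)
    fix z l assume "l < dim_vec (vec (m + 1) (\<lambda>l. \<Sum>j\<le>m. of_real (w j) * vec_index (Gamma_j m lam j (?f j) z) l))"
    then have l: "l < m + 1" by simp
    have "of_real (u j) * vec_index (Gamma_j m lam j (f j) z) l = of_real (w j) * vec_index (Gamma_j m lam j (?f j) z) l"
      if "j \<in> {..m}" for j
    proof -
      have j: "j \<le> m" using that by simp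
      show ?thesis
        using Gamma_j_scale[OF direct_sum_holomorphic(2)[OF A[OF j] j f] l, of lam j "of_real (v j)" z]
        by (simp add: u[OF j] j)
    qed
    then have "(\<Sum>j\<le>m. of_real (u j) * vec_index (Gamma_j m lam j (f j) z) l) =
        (\<Sum>j\<le>m. of_real (w j) * vec_index (Gamma_j m lam j (?f j) z) l)"
      by (rule sum.cong[OF refl])
    then show "vec_index (vec (m + 1) (\<lambda>l. \<Sum>j\<le>m. of_real (u j) * vec_index (Gamma_j m lam j (f j) z) l)) l =
        vec_index (vec (m + 1) (\<lambda>l. \<Sum>j\<le>m. of_real (w j) * vec_index (Gamma_j m lam j (?f j) z) l)) l"
      using l by (simp only: index_vec)
  qed simp
qed

theorem theorem3p1:
  fixes Gt :: "('g::topological_space) monoid"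
    and act :: "'g \<Rightarrow> complex \<Rightarrow> complex"
    and m :: nat and lam :: real and mu :: "nat \<Rightarrow> real"
    and A :: "nat \<Rightarrow> complex fun_space"
  assumes "universal_covering_group Gt act"
    and "m > 0" and "2 * lam - real m > 0"
    and "mu 0 = 1" and "\<And>j. 1 \<le> j \<Longrightarrow> j \<le> m \<Longrightarrow> mu j > 0"
    and "\<And>j. j \<le> m \<Longrightarrow> is_A (lam_j m lam j) (A j)"
  shows "multiplier Gt act (m + 1) (J_mat Gt act m lam) \<and>
    (\<forall>g \<in> carrier Gt. \<forall>F \<in> carrier (A_lam_mu m lam mu A).
       U_rep Gt act m lam mu A g F \<in> carrier (A_lam_mu m lam mu A) \<and>
       (\<forall>z \<in> disc. U_rep Gt act m lam mu A g F z =
          J_mat Gt act m lam (inv\<^bsub>Gt\<^esub> g) z *\<^sub>v F (act (inv\<^bsub>Gt\<^esub> g) z)))"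
proof (intro conjI ballI)
  interpret moebius_cover Gt act using assms(1) by unfold_locales
  show "multiplier Gt act (m + 1) (J_mat Gt act m lam)" by (rule multiplier_J_mat)
  fix g F assume g: "g \<in> carrier Gt" and F: "F \<in> carrier (A_lam_mu m lam mu A)"
  have A: "holomorphic_hilbert_space (A j)" if "j \<le> m" for j
    using assms(6)[OF that] by (simp add: is_A_def)
  have mu: "mu j \<noteq> 0" if "j \<le> m" for j
    using assms(4) assms(5)[of j] that by (cases "j = 0") force+
  let ?D = "direct_sum m A" and ?S = "Gamma_sum m lam mu" and ?S1 = "Gamma_sum m lam (\<lambda>j. 1)"
  have carr: "carrier (A_lam_mu m lam mu A) = ?S1 ` ?D"
    by (simp add: A_lam_mu_def Let_def)
  define f where "f = inv_into ?D ?S F"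
  have "F \<in> ?S ` ?D"
  proof -
    obtain f0 where f0: "f0 \<in> ?D" "F = ?S1 f0" using F carr by auto
    show ?thesis unfolding f0(2)
      by (rule Gamma_sum_rescale[OF A f0(1), where v = "\<lambda>j. 1 / mu j"]) (simp_all add: mu)
  qed
  \<comment> \<open>The computation below uses these two facts about \<open>f\<close>, whichever
    preimage \<open>inv_into\<close> picks.\<close>
  then have f: "f \<in> ?D" "?S f = F" unfolding f_def by (rule inv_into_into, rule f_inv_into_f)
  define Df where "Df = D_plus_sum Gt act m lam g f"
  have Df: "Df \<in> ?D"
    unfolding Df_def D_plus_sum_def direct_sum_def
  proof (rule restrict_PiE_iff[THEN iffD2], intro ballI)
    fix j assume "j \<in> {..m}"
    then have j: "j \<le> m" by simp
    show "D_plus Gt act (lam_j m lam j) g (f j) \<in> carrier (A j)"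
      by (rule D_plus_in[OF g assms(6)[OF j] direct_sum_holomorphic(1)[OF A[OF j] j f(1)]])
  qed
  have U: "U_rep Gt act m lam mu A g F = ?S Df"
    by (simp add: U_rep_def Df_def f_def)
  show "U_rep Gt act m lam mu A g F \<in> carrier (A_lam_mu m lam mu A)"
    unfolding U carr by (rule Gamma_sum_rescale[OF A Df, where v = mu]) simp_all
  fix z :: complex assume z: "z \<in> disc"
  let ?h = "inv\<^bsub>Gt\<^esub> g"
  let ?J = "J_mat Gt act m lam ?h z" and ?w = "act ?h z"
  show "U_rep Gt act m lam mu A g F z = ?J *\<^sub>v F ?w"
    unfolding U
  proof (rule eq_vecI)
    show "dim_vec (?S Df z) = dim_vec (?J *\<^sub>v F ?w)" by (simp add: Gamma_sum_def J_mat_def)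
    fix l assume "l < dim_vec (?J *\<^sub>v F ?w)"
    then have l: "l < m + 1" by (simp add: J_mat_def)
    have "vec_index (?S Df z) l = (\<Sum>j\<le>m. of_real (mu j) * vec_index (Gamma_j m lam j (Df j) z) l)"
      using l by (simp add: Gamma_sum_def)
    also have "\<dots> = (\<Sum>j\<le>m. \<Sum>k<m+1. ?J $$ (l, k) * (of_real (mu j) * vec_index (Gamma_j m lam j (f j) ?w) k))"
    proof (rule sum.cong[OF refl])
      fix j assume "j \<in> {..m}"
      then have j: "j \<le> m" by simp
      have "Df j = D_plus Gt act (lam_j m lam j) g (f j)" using j by (simp add: Df_def D_plus_sum_def)
      then have "vec_index (Gamma_j m lam j (Df j) z) l =
          (\<Sum>k<m+1. ?J $$ (l, k) * vec_index (Gamma_j m lam j (f j) ?w) k)"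
        using Gamma_j_D_plus[OF g direct_sum_holomorphic(2)[OF A[OF j] j f(1)] assms(3) z j l] by simp
      then show "of_real (mu j) * vec_index (Gamma_j m lam j (Df j) z) l =
          (\<Sum>k<m+1. ?J $$ (l, k) * (of_real (mu j) * vec_index (Gamma_j m lam j (f j) ?w) k))"
        by (simp only: sum_distrib_left mult.left_commute)
    qed
    \<comment> \<open>The entry \<open>?J $$ (l, k)\<close> does not depend on \<open>j\<close>, so
      it can be pulled out of the sum over \<open>j\<close> after the exchange.\<close>
    also have "\<dots> = (\<Sum>k<m+1. ?J $$ (l, k) * (\<Sum>j\<le>m. of_real (mu j) * vec_index (Gamma_j m lam j (f j) ?w) k))"
      by (subst sum.swap) (simp only: sum_distrib_left)
    also have "\<dots> = (\<Sum>k<m+1. ?J $$ (l, k) * vec_index (F ?w) k)"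
      by (rule sum.cong[OF refl]) (simp add: f(2)[symmetric] Gamma_sum_def)
    also have "\<dots> = vec_index (?J *\<^sub>v F ?w) l"
    proof -
      have "dim_vec (F ?w) = m + 1" by (simp add: f(2)[symmetric] Gamma_sum_def)
      moreover have "?J \<in> carrier_mat (m + 1) (m + 1)" by (simp add: J_mat_def)
      ultimately show ?thesis using l by (simp add: scalar_prod_def atLeast0LessThan)
    qed
    finally show "vec_index (?S Df z) l = vec_index (?J *\<^sub>v F ?w) l" .
  qed
qed

end
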